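(* Let $\Lambda$ be a finite set, let $\tau:\Lambda^{\mathbb{N}_0}\to\Lambda^{\mathbb{N}_0}$ be a left permutative cellular automaton, and let $\nu$ be a shift-invariant Borel probability measure on $Z_\tau$ that is also invariant relative to $\tau'$. Form a measure $\tilde\mu$ on $\{(A,a):A\subseteq\Lambda,\ a\in A\}^{\mathbb{N}_0}$ by the requirement $$\tilde\mu\left([(A_0,a_0),\dots,(A_n,a_n)]\right)=\frac{\nu([A_0,\dots,A_n])}{|A_0|\cdots|A_n|}$$ for all cylinders, and define $\mu=(\psi_2)_*\tilde\mu$. Then: (i) $\mu$ is invariant relative to both $\sigma$ and $\tau$. (ii) If $\tau$ is bi-permutative and $h_\nu(\sigma)=0$, then $(\pi_\mu)_*\mu=\nu$. (iii) If, in addition to the premises of (ii), $\nu$ is also ergodic relative to the joint action of the shift and $\tau'$, then $\mu$ is ergodic relative to the joint action of the shift and $\tau$.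
   Context: $\mathbb{N}_0$ is the set of non-negative integers; $\sigma$ denotes the left shift on any of the shift spaces involved; $2^\Lambda$ is the set of subsets of $\Lambda$; $[b_0,\dots,b_n]$ is the cylinder of points whose first $n+1$ coordinates are $b_0,\dots,b_n$; $h$ denotes measure-theoretical entropy. A left permutative cellular automaton is a map $\tau:\Lambda^{\mathbb{N}_0}\to\Lambda^{\mathbb{N}_0}$ of the form $(\tau(x))_i=r(x_i,x_{i+1})$ for some $r:\Lambda^2\to\Lambda$ such that $r(\cdot,a):\Lambda\to\Lambda$ is bijective for every fixed $a\in\Lambda$; it is bi-permutative if moreover $r(a,\cdot)$ is bijective for every $a\in\Lambda$. The cellular automaton $\tau':(2^\Lambda)^{\mathbb{N}_0}\to(2^\Lambda)^{\mathbb{N}_0}$ is $(\tau'(A_0,A_1,\dots))_i=\{(\tau(a_0,a_1,\dots))_i:a_j\in A_j\ \text{for all }j\}$. For $1\le k\le|\Lambda|$, $Z_{\tau,k}\subseteq(2^\Lambda)^{\mathbb{N}_0}$ is the subshift of all points $(A_0,A_1,\dots)$ with $|A_i|=k$ for all $i$ and $|((\tau')^n(A_0,A_1,\dots))_i|=k$ for all $n>0$ and all indices $i$; and $Z_\tau=\bigcup_{k=1}^{|\Lambda|}Z_{\tau,k}$. $\psi_2:\{(A,a):A\subseteq\Lambda,\ a\in A\}^{\mathbb{N}_0}\to\Lambda^{\mathbb{N}_0}$ is the component-wise projection $(A,a)\mapsto a$. For $\tau$ bi-permutative and $\mu$ a Borel probability measure on $\Lambda^{\mathbb{N}_0}$ invariant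 under $\sigma$ and $\tau$, with $\mathcal{B}$ the Borel $\sigma$-algebra of $\Lambda^{\mathbb{N}_0}$ and $\mu_x^{\sigma^{-1}\mathcal{B}}$ the conditional probability of $\mu$ given $\sigma^{-1}\mathcal{B}$ at $x$, put $\Lambda_{\mu,x}=\{a\in\Lambda:\mu_x^{\sigma^{-1}\mathcal{B}}(\{(a,x_1,x_2,\dots)\})>0\}$; the map $\pi_\mu:\Lambda^{\mathbb{N}_0}\to(2^\Lambda)^{\mathbb{N}_0}$ is the ($\mu$-almost-surely defined) shift-equivariant map with $(\pi_\mu(x))_0=\Lambda_{\mu,x}$, i.e. $(\pi_\mu(x))_i=\Lambda_{\mu,\sigma^i(x)}$. *)

theory Defs
  imports "HOL-Probability.Probability" "HOL-Library.Disjoint_Sets"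
begin

text \<open>Alphabets are finite and discrete. The full shift over an alphabet \<open>S\<close> is the set of functions
  \<open>nat \<Rightarrow> 'b\<close> with values in \<open>S\<close>; since the index set is countable and \<open>S\<close> is finite, the product
  \<open>\<sigma>\<close>-algebra below is the Borel \<open>\<sigma>\<close>-algebra of the product topology. The finite set \<open>\<Lambda>\<close> is a type
  \<open>'a :: finite\<close>, and \<open>2\<^sup>\<Lambda>\<close> is the type \<open>'a set\<close>.\<close>

definition shift_space :: "'b set \<Rightarrow> (nat \<Rightarrow> 'b) measure" where
  "shift_space S = (\<Pi>\<^sub>M i\<in>UNIV. count_space S)"

abbreviation full_shift :: "(nat \<Rightarrow> 'b) measure" where
  "full_shift \<equiv> shift_space UNIV"

definition left_shift :: "(nat \<Rightarrow> 'b) \<Rightarrow> nat \<Rightarrow> 'b" where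
  "left_shift x = (\<lambda>i. x (Suc i))"

text \<open>The cylinder \<open>[b\<^sub>0, \<dots>, b\<^sub>n]\<close>; the values of \<open>b\<close> beyond \<open>n\<close> are irrelevant.\<close>

definition cylinder :: "'b set \<Rightarrow> nat \<Rightarrow> (nat \<Rightarrow> 'b) \<Rightarrow> (nat \<Rightarrow> 'b) set" where
  "cylinder S n b = {x. (\<forall>i. x i \<in> S) \<and> (\<forall>i\<le>n. x i = b i)}"

definition invariant_measure :: "'b measure \<Rightarrow> ('b \<Rightarrow> 'b) \<Rightarrow> bool" where
  "invariant_measure M T \<longleftrightarrow> T \<in> M \<rightarrow>\<^sub>M M \<and> distr M M T = M"

text \<open>Ergodicity for the joint action of a set of maps. Invariance of \<open>E\<close> is understood up to null
  sets, so that the notion does not depend on how the maps behave outside a set of full measure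
  (\<open>\<nu>\<close> below lives on \<open>Z\<^sub>\<tau>\<close>, but is regarded as a measure on the full shift over \<open>2\<^sup>\<Lambda>\<close>).\<close>

definition jointly_ergodic :: "'b measure \<Rightarrow> ('b \<Rightarrow> 'b) set \<Rightarrow> bool" where
  "jointly_ergodic M \<T> \<longleftrightarrow>
     (\<forall>E\<in>sets M. (\<forall>T\<in>\<T>. AE x in M. T x \<in> E \<longleftrightarrow> x \<in> E) \<longrightarrow> measure M E = 0 \<or> measure M E = 1)"

subsection \<open>Measure-theoretical entropy\<close>

definition finite_partitions :: "'b measure \<Rightarrow> 'b set set set" where
  "finite_partitions M = {P. finite P \<and> P \<subseteq> sets M \<and> partition_on (space M) P}"

text \<open>The convention \<open>0 * ln 0 = 0\<close> holds in HOL.\<close>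

definition partition_entropy :: "'b measure \<Rightarrow> 'b set set \<Rightarrow> real" where
  "partition_entropy M P = - (\<Sum>A\<in>P. measure M A * ln (measure M A))"

text \<open>\<open>P \<or> T\<^sup>-\<^sup>1 P \<or> \<dots> \<or> T\<^bsup>-(n-1)\<^esup> P\<close>\<close>

definition iterated_join :: "'b measure \<Rightarrow> ('b \<Rightarrow> 'b) \<Rightarrow> 'b set set \<Rightarrow> nat \<Rightarrow> 'b set set" where
  "iterated_join M T P n =
     common_refinement ((\<lambda>i. (\<lambda>A. (T ^^ i) -` A \<inter> space M) ` P) ` {..<n})"

definition ks_entropy :: "'b measure \<Rightarrow> ('b \<Rightarrow> 'b) \<Rightarrow> ereal" where
  "ks_entropy M T = (SUP P\<in>finite_partitions M.
     ereal (lim (\<lambda>n. partition_entropy M (iterated_join M T P n) / real n)))"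

subsection \<open>Cellular automata\<close>

definition left_permutative_ca :: "((nat \<Rightarrow> 'a) \<Rightarrow> nat \<Rightarrow> 'a) \<Rightarrow> bool" where
  "left_permutative_ca \<tau> \<longleftrightarrow>
     (\<exists>r. (\<forall>x i. \<tau> x i = r (x i) (x (Suc i))) \<and> (\<forall>a. bij (\<lambda>b. r b a)))"

definition bipermutative_ca :: "((nat \<Rightarrow> 'a) \<Rightarrow> nat \<Rightarrow> 'a) \<Rightarrow> bool" where
  "bipermutative_ca \<tau> \<longleftrightarrow>
     (\<exists>r. (\<forall>x i. \<tau> x i = r (x i) (x (Suc i))) \<and> (\<forall>a. bij (\<lambda>b. r b a)) \<and> (\<forall>a. bij (\<lambda>b. r a b)))"

definition set_ca :: "((nat \<Rightarrow> 'a) \<Rightarrow> nat \<Rightarrow> 'a) \<Rightarrow> (nat \<Rightarrow> 'a set) \<Rightarrow> nat \<Rightarrow> 'a set" where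
  "set_ca \<tau> A = (\<lambda>i. {\<tau> a i |a. \<forall>j. a j \<in> A j})"

definition Z_k :: "((nat \<Rightarrow> 'a) \<Rightarrow> nat \<Rightarrow> 'a) \<Rightarrow> nat \<Rightarrow> (nat \<Rightarrow> 'a set) set" where
  "Z_k \<tau> k = {A. (\<forall>i. card (A i) = k) \<and> (\<forall>n>0. \<forall>i. card ((set_ca \<tau> ^^ n) A i) = k)}"

definition Z :: "((nat \<Rightarrow> 'a::finite) \<Rightarrow> nat \<Rightarrow> 'a) \<Rightarrow> (nat \<Rightarrow> 'a set) set" where
  "Z \<tau> = (\<Union>k\<in>{1..CARD('a)}. Z_k \<tau> k)"

subsection \<open>The measures \<open>\<mu>\<close> with tilde and \<open>\<mu>\<close>\<close>

definition pointed_sets :: "('a set \<times> 'a) set" where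
  "pointed_sets = {(A, a). a \<in> A}"

text \<open>The requirement on cylinders determines the measure uniquely.\<close>

definition tilde_measure :: "(nat \<Rightarrow> 'a::finite set) measure \<Rightarrow> (nat \<Rightarrow> 'a set \<times> 'a) measure" where
  "tilde_measure \<nu> = (THE M. sets M = sets (shift_space pointed_sets) \<and>
     (\<forall>n b. (\<forall>i\<le>n. b i \<in> pointed_sets) \<longrightarrow>
        emeasure M (cylinder pointed_sets n b) =
        emeasure \<nu> (cylinder UNIV n (\<lambda>i. fst (b i))) / of_nat (\<Prod>i\<le>n. card (fst (b i)))))"

definition psi2 :: "(nat \<Rightarrow> 'a set \<times> 'a) \<Rightarrow> nat \<Rightarrow> 'a" where
  "psi2 x = (\<lambda>i. snd (x i))"

definition projected_measure :: "(nat \<Rightarrow> 'a::finite set) measure \<Rightarrow> (nat \<Rightarrow> 'a) measure" where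
  "projected_measure \<nu> = distr (tilde_measure \<nu>) full_shift psi2"

subsection \<open>Conditional probabilities and the map \<open>\<pi>\<^sub>\<mu>\<close>\<close>

text \<open>A regular version \<open>x \<mapsto> \<mu>\<^sub>x\<close> of the conditional probabilities of \<open>M\<close> given a sub-\<open>\<sigma>\<close>-algebra \<open>F\<close>;
  it is only determined almost everywhere, so some version is fixed.\<close>

definition regular_cond_prob :: "'b measure \<Rightarrow> 'b measure \<Rightarrow> ('b \<Rightarrow> 'b measure) \<Rightarrow> bool" where
  "regular_cond_prob M F \<kappa> \<longleftrightarrow> \<kappa> \<in> F \<rightarrow>\<^sub>M prob_algebra M \<and>
     (\<forall>A\<in>sets M. AE x in M. measure (\<kappa> x) A = real_cond_exp M F (indicator A) x)"

definition cond_measure :: "'b measure \<Rightarrow> 'b measure \<Rightarrow> 'b \<Rightarrow> 'b measure" where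
  "cond_measure M F = (SOME \<kappa>. regular_cond_prob M F \<kappa>)"

definition Lambda_set :: "(nat \<Rightarrow> 'a) measure \<Rightarrow> (nat \<Rightarrow> 'a) \<Rightarrow> 'a set" where
  "Lambda_set \<mu> x =
     {a. measure (cond_measure \<mu> (vimage_algebra (space \<mu>) left_shift \<mu>) x) {x(0 := a)} > 0}"

definition pi_map :: "(nat \<Rightarrow> 'a) measure \<Rightarrow> (nat \<Rightarrow> 'a) \<Rightarrow> nat \<Rightarrow> 'a set" where
  "pi_map \<mu> x = (\<lambda>i. Lambda_set \<mu> ((left_shift ^^ i) x))"

end

theory Submission
  imports Defs
begin

text \<open>Given \<open>A\<close>, the letters \<open>a\<^sub>i\<close> are independent and uniform in \<open>A\<^sub>i\<close>; write \<open>K\<^sub>A\<close> for this product measure,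
  so that \<open>\<mu> = \<integral> K\<^sub>A d\<nu>(A)\<close>. For \<open>A \<in> Z\<^sub>\<tau>\<close>, left permutativity and equality of cardinalities show that
  \<open>\<tau>\<close> maps \<open>K\<^sub>A\<close> to the fibre measure of \<open>\<tau>'(A)\<close>, whence (i). For (iii), a shift-invariant event has
  \<open>K\<^sub>A\<close>-probability 0 or 1 by the zero-one law, so it comes from an event in the base, which is trivial
  by ergodicity of \<open>\<nu>\<close>.

  For (ii), let \<open>q\<close> be the uniform distribution on \<open>A\<^sub>0\<close> and \<open>P\<^sub>m\<close> the conditional law of \<open>x\<^sub>0\<close> given
  \<open>x\<^sub>1, \<dots>, x\<^sub>m\<close>. The expected relative entropies of \<open>q\<close> with respect to \<open>P\<^sub>m\<close>, summed over \<open>m < n\<close>, telescope to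
  \<open>H\<^sub>n(\<mu>) - n E[ln |A\<^sub>0|]\<close>, which is at most \<open>H\<^sub>n(\<nu>) = o(n)\<close>. As relative entropy dominates the squared
  Hellinger distance, \<open>P\<^sub>m\<close> converges to \<open>q\<close> almost surely along a subsequence, so \<open>A\<^sub>0\<close> is a function of
  \<open>\<sigma>(x)\<close> and the conditional law of \<open>x\<^sub>0\<close> given \<open>\<sigma>(x)\<close> is uniform on \<open>A\<^sub>0\<close>. Hence
  \<open>\<Lambda>\<^bsub>\<mu>,x\<^esub> = A\<^sub>0\<close>.\<close>

subsection \<open>Cylinders\<close>

text \<open>Three objects are given by description only: \<open>tilde_measure\<close> by
  \<open>THE\<close>, the entropy of a partition by \<open>lim\<close>, the conditional measure by
  \<open>SOME\<close>. Each says nothing until existence is known. Hence the law of (A, a) is built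
  from the kernel A \<mapsto> K_A, convergence of H_n / n is derived from concavity of n \<mapsto>
  H_n, and an explicit version of the conditional measure is exhibited. The obstacle in (ii) is that
  \<mu> forgets A, and that its entropy need not vanish: the uniform choices add E[ln |A_0|] per
  letter. Only the entropy beyond these choices is small, and comparing q with P_m isolates exactly
  this excess. The two laws can be compared because, given A, the letter x_0 may be redrawn without
  touching \<sigma>(x). As P_m is a ratio of word probabilities and a subsequence suffices,
  smallness in mean is enough and no martingale convergence is involved.\<close>

lemma space_shift_space: "space (shift_space S) = {x. \<forall>i. x i \<in> S}"
  by (auto simp: shift_space_def space_PiM PiE_def)

lemma space_full_shift [simp]: "space full_shift = UNIV"
  by (simp add: space_shift_space)

lemma measurable_shift_coord [measurable]:
  "(\<lambda>x. x i) \<in> measurable (shift_space S) (count_space S)"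
  unfolding shift_space_def by measurable

lemma measurable_into_shift_space:
  assumes "\<And>i. (\<lambda>x. f x i) \<in> measurable M (count_space S)"
  shows "f \<in> measurable M (shift_space S)"
  unfolding shift_space_def
  by (rule measurable_PiM_single') (use assms in \<open>auto simp: measurable_def\<close>)

lemma measurable_into_full_shift:
  assumes "\<And>i. (\<lambda>x. f x i) \<in> measurable M (count_space UNIV)"
  shows "f \<in> measurable M full_shift"
  by (rule measurable_into_shift_space) (rule assms)

lemma measurable_left_shift [measurable]: "left_shift \<in> measurable full_shift full_shift"
  by (rule measurable_into_full_shift) (simp add: left_shift_def measurable_shift_coord)

lemma left_shift_funpow: "(left_shift ^^ n) x i = x (n + i)"
  by (induction n arbitrary: x i) (auto simp: left_shift_def)

lemma cylinder_in_sets: "cylinder S n b \<in> sets (shift_space S)"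
proof -
  have "cylinder S n b = (\<Inter>i\<in>{..n}. (\<lambda>x. x i) -` ({b i} \<inter> S) \<inter> space (shift_space S))"
    by (auto simp: cylinder_def space_shift_space)
  also have "\<dots> \<in> sets (shift_space S)"
    by (intro sets.finite_INT measurable_sets[OF measurable_shift_coord]) auto
  finally show ?thesis .
qed

text \<open>Two cylinders are nested or disjoint, so adjoining the empty set closes the family under
  intersection.\<close>

lemma Int_stable_cylinders:
  "Int_stable (insert {} {cylinder S n b | n b. \<forall>i\<le>n. b i \<in> S})"
proof -
  have *: "cylinder S n b \<inter> cylinder S m c \<in> insert {} {cylinder S n b | n b. \<forall>i\<le>n. b i \<in> S}"
    if "n \<le> m" "\<forall>i\<le>n. b i \<in> S" "\<forall>i\<le>m. c i \<in> S" for n m b c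
  proof (cases "\<forall>i\<le>n. b i = c i")
    case True
    then have "cylinder S n b \<inter> cylinder S m c = cylinder S m c"
      using that(1) by (auto simp: cylinder_def)
    then show ?thesis
      using that(3) by auto
  next
    case False
    then have "cylinder S n b \<inter> cylinder S m c = {}"
      using that(1) by (auto simp: cylinder_def)
    then show ?thesis
      by simp
  qed
  show ?thesis
    unfolding Int_stable_def
  proof (intro ballI)
    fix X Y assume XY: "X \<in> insert {} {cylinder S n b | n b. \<forall>i\<le>n. b i \<in> S}"
      "Y \<in> insert {} {cylinder S n b | n b. \<forall>i\<le>n. b i \<in> S}"
    show "X \<inter> Y \<in> insert {} {cylinder S n b | n b. \<forall>i\<le>n. b i \<in> S}"
    proof (cases "X = {} \<or> Y = {}")
      case False
      then obtain n b m c where 1: "X = cylinder S n b" "\<forall>i\<le>n. b i \<in> S"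
        "Y = cylinder S m c" "\<forall>i\<le>m. c i \<in> S"
        using XY by auto
      show ?thesis
        using *[of n m b c] *[of m n c b] 1 nat_le_linear[of n m] by (auto simp: Int_commute)
    qed auto
  qed
qed

text \<open>Finiteness of the alphabet makes an event about a single coordinate a finite union of
  cylinders.\<close>

lemma sets_shift_space_cylinders:
  assumes "finite S"
  shows "sets (shift_space S) =
    sigma_sets {x. \<forall>i. x i \<in> S} (insert {} {cylinder S n b | n b. \<forall>i\<le>n. b i \<in> S})"
    (is "_ = sigma_sets ?\<Omega> ?G")
proof (rule antisym)
  have G: "?G \<subseteq> Pow ?\<Omega>"
    by (auto simp: cylinder_def)
  interpret sigma_algebra ?\<Omega> "sigma_sets ?\<Omega> ?G"
    using G by (rule sigma_algebra_sigma_sets)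
  have coord: "{x. (\<forall>i. x i \<in> S) \<and> x i \<in> A} \<in> sigma_sets ?\<Omega> ?G" if "A \<subseteq> S" for i A
  proof -
    have "{x. (\<forall>i. x i \<in> S) \<and> x i \<in> A} =
      (\<Union>b\<in>{b \<in> PiE {..i} (\<lambda>_. S). b i \<in> A}. cylinder S i b)" (is "?l = ?r")
    proof
      show "?l \<subseteq> ?r"
      proof
        fix x assume "x \<in> ?l"
        then show "x \<in> ?r"
          by (intro UN_I[of "restrict x {..i}"]) (auto simp: cylinder_def)
      qed
    qed (auto simp: cylinder_def)
    moreover have "?r \<in> sigma_sets ?\<Omega> ?G"
    proof (rule finite_UN)
      show "finite {b \<in> PiE {..i} (\<lambda>_. S). b i \<in> A}"
        by (rule finite_subset[of _ "PiE {..i} (\<lambda>_. S)"]) (auto simp: assms finite_PiE)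
      fix b assume "b \<in> {b \<in> PiE {..i} (\<lambda>_. S). b i \<in> A}"
      then show "cylinder S i b \<in> sigma_sets ?\<Omega> ?G"
        by (intro sigma_sets.Basic) (auto simp: PiE_iff)
    qed
    ultimately show ?thesis by simp
  qed
  show "sets (shift_space S) \<subseteq> sigma_sets ?\<Omega> ?G"
    unfolding shift_space_def sets_PiM_single
  proof -
    have "sigma_sets (\<Pi>\<^sub>E i\<in>UNIV. space (count_space S))
        {{f \<in> \<Pi>\<^sub>E i\<in>UNIV. space (count_space S). f i \<in> A} |i A. i \<in> UNIV \<and> A \<in> sets (count_space S)}
      = sigma_sets ?\<Omega> {{f. (\<forall>i. f i \<in> S) \<and> f i \<in> A} |i A. A \<subseteq> S}"
      by (intro arg_cong2[where f=sigma_sets]) (auto simp: PiE_def)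
    also have "\<dots> \<subseteq> sigma_sets ?\<Omega> ?G"
      using coord by (intro sigma_sets_subset) auto
    finally show "sigma_sets (\<Pi>\<^sub>E i\<in>UNIV. space (count_space S))
        {{f \<in> \<Pi>\<^sub>E i\<in>UNIV. space (count_space S). f i \<in> A} |i A. i \<in> UNIV \<and> A \<in> sets (count_space S)}
        \<subseteq> sigma_sets ?\<Omega> ?G" .
  qed
  show "sigma_sets ?\<Omega> ?G \<subseteq> sets (shift_space S)"
  proof -
    have "sigma_sets (space (shift_space S)) ?G \<subseteq> sets (shift_space S)"
      using cylinder_in_sets by (intro sets.sigma_sets_subset) auto
    then show ?thesis by (simp add: space_shift_space)
  qed
qed

text \<open>Finiteness is asked on cylinders only: in the uniqueness proof for
  \<open>tilde_measure\<close> nothing but the values on cylinders is known of the competing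
  measure. The one-letter cylinders form the required countable cover.\<close>

lemma measure_eqI_cylinder:
  assumes S: "finite S"
    and M: "sets M = sets (shift_space S)" and N: "sets N = sets (shift_space S)"
    and eq: "\<And>n b. (\<forall>i\<le>n. b i \<in> S) \<Longrightarrow> emeasure M (cylinder S n b) = emeasure N (cylinder S n b)"
    and fin: "\<And>n b. (\<forall>i\<le>n. b i \<in> S) \<Longrightarrow> emeasure M (cylinder S n b) \<noteq> \<infinity>"
  shows "M = N"
proof (rule measure_eqI_generator_eq_countable[OF Int_stable_cylinders[of S]])
  show "(\<Union>s\<in>S. {cylinder S 0 (\<lambda>_. s)}) \<subseteq> insert {} {cylinder S n b | n b. \<forall>i\<le>n. b i \<in> S}"
    by auto
  show "\<Union> (\<Union>s\<in>S. {cylinder S 0 (\<lambda>_. s)}) = {x. \<forall>i. x i \<in> S}"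
    by (auto simp: cylinder_def)
  show "countable (\<Union>s\<in>S. {cylinder S 0 (\<lambda>_. s)})"
    using S by (intro countable_finite) auto
  fix a assume "a \<in> (\<Union>s\<in>S. {cylinder S 0 (\<lambda>_. s)})"
  then show "emeasure M a \<noteq> \<infinity>"
    using fin by auto
next
  fix X assume "X \<in> insert {} {cylinder S n b | n b. \<forall>i\<le>n. b i \<in> S}"
  then show "emeasure M X = emeasure N X"
    using eq by auto
next
  show "insert {} {cylinder S n b | n b. \<forall>i\<le>n. b i \<in> S} \<subseteq> Pow {x. \<forall>i. x i \<in> S}"
    by (auto simp: cylinder_def)
qed (simp_all only: M N sets_shift_space_cylinders[OF S])

section \<open>Finite words and their cylinders\<close>

definition word :: "nat \<Rightarrow> (nat \<Rightarrow> 'b) \<Rightarrow> 'b list" where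
  "word n x = map x [0..<n]"

text \<open>Unlike \<open>cylinder\<close>, which always fixes at least one coordinate, this form
  allows the empty word, so that statements about cylinders can be proved by induction on the
  list.\<close>

definition cyl :: "'b list \<Rightarrow> (nat \<Rightarrow> 'b) set" where
  "cyl w = {x. word (length w) x = w}"

lemma length_word [simp]: "length (word n x) = n"
  by (simp add: word_def)

lemma nth_word: "i < n \<Longrightarrow> word n x ! i = x i"
  by (simp add: word_def)

lemma word_0 [simp]: "word 0 x = []"
  by (simp add: word_def)

lemma word_Suc: "word (Suc n) x = x 0 # word n (left_shift x)"
  by (auto simp: word_def left_shift_def upt_conv_Cons map_Suc_upt simp del: upt_Suc
    simp flip: map_Suc_upt)

lemma word_eq_iff: "word n x = word n y \<longleftrightarrow> (\<forall>i<n. x i = y i)"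
  by (auto simp: word_def)

lemma cyl_Nil [simp]: "cyl [] = UNIV"
  by (simp add: cyl_def)

lemma in_cyl_Cons [simp]: "x \<in> cyl (a # w) \<longleftrightarrow> x 0 = a \<and> left_shift x \<in> cyl w"
  by (auto simp: cyl_def word_Suc)

lemma in_cyl_word: "y \<in> cyl (word n x) \<longleftrightarrow> word n y = word n x"
  by (simp add: cyl_def)

lemma cylinder_eq_cyl: "cylinder UNIV n b = cyl (word (Suc n) b)"
  by (auto simp: cylinder_def cyl_def word_eq_iff less_Suc_eq_le)

lemma measurable_case_nat [measurable]:
  "case_nat a \<in> measurable full_shift full_shift"
proof (rule measurable_into_full_shift)
  fix i show "(\<lambda>x. case_nat a x i) \<in> measurable full_shift (count_space UNIV)"
    by (cases i) (auto intro: measurable_shift_coord)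
qed

lemma left_shift_case_nat [simp]: "left_shift (case_nat a y) = y"
  by (simp add: left_shift_def)

lemma case_nat_left_shift: "case_nat a (left_shift x) = x(0 := a)"
  by (auto simp: fun_eq_iff left_shift_def split: nat.split)

lemma cyl_in_sets [measurable]: "cyl (w :: 'b::finite list) \<in> sets full_shift"
proof (induction w)
  case Nil
  then show ?case using sets.top[of "full_shift :: (nat \<Rightarrow> 'b) measure"] by simp
next
  case (Cons a w)
  have "cyl (a # w) = ((\<lambda>x. x 0) -` {a} \<inter> space full_shift) \<inter> (left_shift -` cyl w \<inter> space full_shift)"
    by auto
  also have "\<dots> \<in> sets full_shift"
    by (intro sets.Int measurable_sets[OF measurable_shift_coord] measurable_sets[OF measurable_left_shift] Cons) auto
  finally show ?case .
qed

lemma measurable_word [measurable]: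
  "word n \<in> measurable (full_shift :: (nat \<Rightarrow> 'b::finite) measure) (count_space UNIV)"
proof (subst measurable_count_space_eq2_countable, safe)
  fix w :: "'b list"
  have "word n -` {w} \<inter> space full_shift = (if length w = n then cyl w else {})"
    by (auto simp: cyl_def)
  then show "word n -` {w} \<inter> space full_shift \<in> sets full_shift"
    by simp
qed auto

lemma measure_eqI_cyl:
  fixes M N :: "(nat \<Rightarrow> 'b::finite) measure"
  assumes "sets M = sets full_shift" "sets N = sets full_shift" "finite_measure M"
    and "\<And>w. emeasure M (cyl w) = emeasure N (cyl w)"
  shows "M = N"
proof (rule measure_eqI_cylinder[of UNIV])
  fix n :: nat and b :: "nat \<Rightarrow> 'b"
  show "emeasure M (cylinder UNIV n b) = emeasure N (cylinder UNIV n b)"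
    by (simp add: cylinder_eq_cyl assms(4))
  show "emeasure M (cylinder UNIV n b) \<noteq> \<infinity>"
    using finite_measure.emeasure_finite[OF assms(3)] by simp
qed (use assms in auto)

subsection \<open>The fibre measures\<close>

text \<open>This is K_A. If some \<open>A i\<close> is empty, \<open>pmf_of_set (A i)\<close> is
  still a probability mass function by its type, so every fibre is a probability measure and the
  kernel needs no case distinction.\<close>

definition fibre_measure :: "(nat \<Rightarrow> 'a::finite set) \<Rightarrow> (nat \<Rightarrow> 'a) measure" where
  "fibre_measure A = (\<Pi>\<^sub>M i\<in>UNIV. measure_pmf (pmf_of_set (A i)))"

lemma sets_fibre_measure [simp, measurable_cong]: "sets (fibre_measure A) = sets full_shift"
  unfolding fibre_measure_def shift_space_def by (intro sets_PiM_cong) auto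

lemma space_fibre_measure [simp]: "space (fibre_measure A) = UNIV"
  using sets_eq_imp_space_eq[OF sets_fibre_measure, of A] by simp

lemma prob_space_fibre_measure: "prob_space (fibre_measure A)"
  unfolding fibre_measure_def by (intro prob_space_PiM measure_pmf.prob_space_axioms)

lemma emeasure_fibre_measure_cyl:
  "emeasure (fibre_measure A) (cyl w) = (\<Prod>i<length w. ennreal (pmf (pmf_of_set (A i)) (w ! i)))"
proof -
  interpret product_prob_space "\<lambda>i. measure_pmf (pmf_of_set (A i))" "UNIV :: nat set"
    by (rule product_prob_spaceI) (rule measure_pmf.prob_space_axioms)
  have "cyl w = {x \<in> space (\<Pi>\<^sub>M i\<in>UNIV. measure_pmf (pmf_of_set (A i))). \<forall>i\<in>{..<length w}. x i \<in> {w ! i}}"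
    unfolding cyl_def space_PiM list_eq_iff_nth_eq by (auto simp: nth_word)
  then show ?thesis
    unfolding fibre_measure_def using emeasure_PiM_Collect[of "{..<length w}" "\<lambda>i. {w ! i}"]
    by (simp add: emeasure_pmf_single)
qed

lemma emeasure_fibre_measure_cyl_Cons:
  "emeasure (fibre_measure A) (cyl (a # w)) =
     ennreal (pmf (pmf_of_set (A 0)) a) * emeasure (fibre_measure (left_shift A)) (cyl w)"
  by (simp add: emeasure_fibre_measure_cyl prod.lessThan_Suc_shift left_shift_def
      del: prod.lessThan_Suc)

lemma measurable_fibre_measure [measurable]:
  "fibre_measure \<in> measurable full_shift (prob_algebra (full_shift :: (nat \<Rightarrow> 'a::finite) measure))"
proof (rule measurable_prob_algebra_generated[OF sets_shift_space_cylinders[OF finite] Int_stable_cylinders])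
  fix E :: "(nat \<Rightarrow> 'a) set"
  assume "E \<in> insert {} {cylinder UNIV n b |n b. \<forall>i\<le>n. b i \<in> UNIV}"
  moreover have "(\<lambda>A. ennreal (pmf (pmf_of_set (A i)) c)) \<in> borel_measurable full_shift" for i and c :: 'a
    by (rule measurable_compose[OF measurable_shift_coord]) simp
  then have "(\<lambda>A. emeasure (fibre_measure A) (cyl w)) \<in> borel_measurable full_shift" for w :: "'a list"
    unfolding emeasure_fibre_measure_cyl by (intro borel_measurable_prod_ennreal)
  ultimately show "(\<lambda>A. emeasure (fibre_measure A) E) \<in> borel_measurable full_shift"
    by (auto simp: cylinder_eq_cyl)
qed (auto simp: prob_space_fibre_measure)

lemma measurable_fibre_measure_subprob [measurable]:
  "fibre_measure \<in> measurable full_shift (subprob_algebra (full_shift :: (nat \<Rightarrow> 'a::finite) measure))"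
  by (rule measurable_prob_algebraD[OF measurable_fibre_measure])

lemma measurable_case_nat_pair:
  "(\<lambda>(a, y). case_nat a y) \<in> measurable (count_space UNIV \<Otimes>\<^sub>M full_shift) full_shift"
proof (rule measurable_into_full_shift)
  fix i
  show "(\<lambda>x. (case x of (a, y) \<Rightarrow> case_nat a y) i) \<in> measurable (count_space UNIV \<Otimes>\<^sub>M full_shift) (count_space UNIV)"
    by (cases i) (auto simp: case_prod_beta
      intro: measurable_fst measurable_compose[OF measurable_snd measurable_shift_coord])
qed

text \<open>The first letter is independent of the tail, and the tail has the fibre measure of the
  shifted sequence of sets. Inductions over words and the resampling of x_0 rest on this.\<close>

lemma fibre_measure_split:
  "fibre_measure A = distr (measure_pmf (pmf_of_set (A 0)) \<Otimes>\<^sub>M fibre_measure (left_shift A))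
     full_shift (\<lambda>(a, y). case_nat a y)" (is "_ = distr ?P _ ?f")
proof (rule measure_eqI_cyl)
  interpret prob_space "fibre_measure A" by (rule prob_space_fibre_measure)
  show "finite_measure (fibre_measure A)" by (rule finite_measure_axioms)
  interpret T: prob_space "fibre_measure (left_shift A)" by (rule prob_space_fibre_measure)
  interpret P: prob_space ?P
    by (intro prob_space_pair prob_space_fibre_measure measure_pmf.prob_space_axioms)
  have f: "?f \<in> measurable ?P full_shift"
    using measurable_case_nat_pair by (subst measurable_cong_sets[OF sets_pair_measure_cong refl]) auto
  fix w :: "'a list"
  show "emeasure (fibre_measure A) (cyl w) = emeasure (distr ?P full_shift ?f) (cyl w)"
  proof (cases w)
    case Nil
    then show ?thesis
      using P.emeasure_space_1 emeasure_space_1 f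
      by (simp add: emeasure_distr cyl_in_sets[of "[]", simplified])
  next
    case (Cons a v)
    have "?f -` cyl w \<inter> space ?P = {a} \<times> cyl v"
      by (auto simp: Cons space_pair_measure)
    then show ?thesis
      using f unfolding Cons emeasure_fibre_measure_cyl_Cons
      by (simp add: emeasure_distr T.emeasure_pair_measure_Times emeasure_pmf_single Cons)
  qed
qed auto

lemma nn_integral_fibre_measure_split:
  fixes A :: "nat \<Rightarrow> 'a::finite set"
  assumes f: "f \<in> borel_measurable full_shift"
  shows "(\<integral>\<^sup>+x. f x \<partial>fibre_measure A) =
    (\<Sum>a\<in>UNIV. ennreal (pmf (pmf_of_set (A 0)) a) * (\<integral>\<^sup>+y. f (case_nat a y) \<partial>fibre_measure (left_shift A)))"
proof -
  interpret prob_space "fibre_measure (left_shift A)" by (rule prob_space_fibre_measure)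
  have 1: "(\<lambda>(a, y). case_nat a y) \<in> measurable
      (measure_pmf (pmf_of_set (A 0)) \<Otimes>\<^sub>M fibre_measure (left_shift A)) full_shift"
    using measurable_case_nat_pair by (subst measurable_cong_sets[OF sets_pair_measure_cong refl]) auto
  have "(\<integral>\<^sup>+x. f x \<partial>fibre_measure A) = (\<integral>\<^sup>+p. f (case p of (a, y) \<Rightarrow> case_nat a y)
      \<partial>(measure_pmf (pmf_of_set (A 0)) \<Otimes>\<^sub>M fibre_measure (left_shift A)))"
    by (subst fibre_measure_split, subst nn_integral_distr[OF 1]) (simp_all add: f)
  also have "\<dots> = (\<integral>\<^sup>+a. \<integral>\<^sup>+y. f (case_nat a y) \<partial>fibre_measure (left_shift A) \<partial>measure_pmf (pmf_of_set (A 0)))"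
    using nn_integral_fst[OF measurable_compose[OF 1 f]] by simp
  also have "\<dots> = (\<Sum>a\<in>UNIV. ennreal (pmf (pmf_of_set (A 0)) a) * (\<integral>\<^sup>+y. f (case_nat a y) \<partial>fibre_measure (left_shift A)))"
    by (subst nn_integral_measure_pmf) (simp add: nn_integral_count_space_finite)
  finally show ?thesis .
qed

lemma sum_pmf_UNIV: "(\<Sum>a\<in>UNIV. ennreal (pmf p (a::'a::finite))) = 1"
  using emeasure_measure_pmf_finite[of UNIV p] by simp

lemma emeasure_fibre_measure_Int:
  assumes E: "E \<in> sets full_shift"
  shows "emeasure (fibre_measure A) {x. x 0 = a \<and> left_shift x \<in> E} =
    ennreal (pmf (pmf_of_set (A 0)) a) * emeasure (fibre_measure (left_shift A)) E"
proof -
  have "{x. x 0 = a \<and> left_shift x \<in> E} = cyl [a] \<inter> (left_shift -` E \<inter> space full_shift)"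
    by auto
  also have "\<dots> \<in> sets full_shift"
    using E by (intro sets.Int cyl_in_sets measurable_sets[OF measurable_left_shift])
  finally have S: "{x. x 0 = a \<and> left_shift x \<in> E} \<in> sets full_shift" .
  have "emeasure (fibre_measure A) {x. x 0 = a \<and> left_shift x \<in> E} =
      (\<integral>\<^sup>+x. indicator {x. x 0 = a \<and> left_shift x \<in> E} x \<partial>fibre_measure A)"
    using S by (subst nn_integral_indicator) auto
  also have "\<dots> = (\<Sum>b\<in>UNIV. ennreal (pmf (pmf_of_set (A 0)) b) *
      (\<integral>\<^sup>+y. indicator {x. x 0 = a \<and> left_shift x \<in> E} (case_nat b y) \<partial>fibre_measure (left_shift A)))"
    using S by (intro nn_integral_fibre_measure_split) auto
  also have "\<dots> = (\<Sum>b\<in>UNIV. if b = a then ennreal (pmf (pmf_of_set (A 0)) b) *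
      emeasure (fibre_measure (left_shift A)) E else 0)"
  proof (intro sum.cong refl)
    fix b
    have "(\<lambda>y. indicator {x. x 0 = a \<and> left_shift x \<in> E} (case_nat b y) :: ennreal) =
      (if b = a then indicator E else (\<lambda>_. 0))"
      by (auto simp: fun_eq_iff indicator_def)
    then show "ennreal (pmf (pmf_of_set (A 0)) b) *
      (\<integral>\<^sup>+y. indicator {x. x 0 = a \<and> left_shift x \<in> E} (case_nat b y) \<partial>fibre_measure (left_shift A)) =
      (if b = a then ennreal (pmf (pmf_of_set (A 0)) b) * emeasure (fibre_measure (left_shift A)) E else 0)"
      using E by auto
  qed
  finally show ?thesis by simp
qed

lemma distr_fibre_measure_left_shift:
  "distr (fibre_measure A) full_shift left_shift = fibre_measure (left_shift A)"
proof (rule measure_eqI)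
  fix E assume "E \<in> sets (distr (fibre_measure A) full_shift left_shift)"
  then have E: "E \<in> sets full_shift" by simp
  have S: "left_shift -` E \<in> sets full_shift"
    using measurable_sets[OF measurable_left_shift E] by simp
  have "emeasure (distr (fibre_measure A) full_shift left_shift) E = (\<integral>\<^sup>+x. indicator (left_shift -` E) x \<partial>fibre_measure A)"
    using E S by (subst nn_integral_indicator) (auto simp: emeasure_distr)
  also have "\<dots> = (\<Sum>a\<in>UNIV. ennreal (pmf (pmf_of_set (A 0)) a) * (\<integral>\<^sup>+y. indicator E y \<partial>fibre_measure (left_shift A)))"
  proof -
    have "(indicator (left_shift -` E) (case_nat a y) :: ennreal) = indicator E y" for a :: 'a and y
      by (auto split: split_indicator)
    then show ?thesis
      using S by (subst nn_integral_fibre_measure_split) auto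
  qed
  also have "\<dots> = emeasure (fibre_measure (left_shift A)) E"
    using E by (simp add: sum_pmf_UNIV flip: sum_distrib_right)
  finally show "emeasure (distr (fibre_measure A) full_shift left_shift) E = emeasure (fibre_measure (left_shift A)) E" .
qed simp

lemma AE_fibre_measure_mem:
  assumes "\<And>i. A i \<noteq> {}"
  shows "AE x in fibre_measure A. \<forall>i. x i \<in> A i"
  unfolding AE_all_countable fibre_measure_def
proof
  fix i
  show "AE x in (\<Pi>\<^sub>M i\<in>UNIV. measure_pmf (pmf_of_set (A i))). x i \<in> A i"
    using set_pmf_of_set[OF assms finite, of i]
    by (intro AE_PiM_component[where P="\<lambda>a. a \<in> A i"] AE_pmfI measure_pmf.prob_space_axioms) auto
qed

lemma emeasure_fibre_measure_UNIV [simp]: "emeasure (fibre_measure A) UNIV = 1"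
  using prob_space.emeasure_space_1[OF prob_space_fibre_measure, of A] by simp

section \<open>Cellular automata acting on the fibres\<close>

lemma measurable_ca:
  fixes \<tau> :: "(nat \<Rightarrow> 'a::finite) \<Rightarrow> nat \<Rightarrow> 'a"
  assumes r: "\<And>x i. \<tau> x i = r (x i) (x (Suc i))"
  shows "\<tau> \<in> measurable full_shift full_shift"
proof (rule measurable_into_full_shift)
  fix i
  have "(\<lambda>x. r (x i) (x (Suc i))) \<in> measurable full_shift (count_space UNIV)"
    by (rule measurable_compose_countable[where g="\<lambda>x. x i" and f="\<lambda>a x. r a (x (Suc i))"])
      (rule measurable_shift_coord measurable_compose[OF measurable_shift_coord] | simp)+
  then show "(\<lambda>x. \<tau> x i) \<in> measurable full_shift (count_space UNIV)"
    by (simp add: r)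
qed

lemma set_ca_eq:
  assumes r: "\<And>x i. \<tau> x i = r (x i) (x (Suc i))" and A: "\<And>i. A i \<noteq> {}"
  shows "set_ca \<tau> A i = {r a b | a b. a \<in> A i \<and> b \<in> A (Suc i)}"
proof (intro set_eqI iffI)
  fix c assume "c \<in> {r a b | a b. a \<in> A i \<and> b \<in> A (Suc i)}"
  then obtain a b where c: "c = r a b" "a \<in> A i" "b \<in> A (Suc i)"
    by auto
  \<comment> \<open>A pair of letters extends to a whole point because the other sets are nonempty;
    without this the image set would be empty.\<close>
  define x where "x = (\<lambda>j. SOME a. a \<in> A j)(i := a, Suc i := b)"
  have "x j \<in> A j" for j
    using c A[of j] by (auto simp: x_def some_in_eq)
  moreover have "\<tau> x i = c"
    by (simp add: r c x_def)
  ultimately show "c \<in> set_ca \<tau> A i"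
    unfolding set_ca_def by auto
qed (auto simp: set_ca_def r)

lemma pmf_of_set_bij_image:
  fixes A B :: "'a::finite set"
  assumes "inj f" "A \<noteq> {}"
  shows "(\<Sum>a\<in>UNIV. ennreal (pmf (pmf_of_set A) a) * indicator {a. f a = c} a) = ennreal (pmf (pmf_of_set (f ` A)) c)"
proof -
  have "pmf_of_set (f ` A) = map_pmf f (pmf_of_set A)"
    using assms by (subst map_pmf_of_set_inj) (auto intro: inj_on_subset)
  then have "ennreal (pmf (pmf_of_set (f ` A)) c) = emeasure (measure_pmf (pmf_of_set A)) (f -` {c})"
    by (simp add: pmf_map measure_pmf.emeasure_eq_measure)
  also have "\<dots> = (\<Sum>a\<in>f -` {c}. ennreal (pmf (pmf_of_set A) a))"
    by (simp add: emeasure_measure_pmf_finite)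
  also have "\<dots> = (\<Sum>a\<in>UNIV. ennreal (pmf (pmf_of_set A) a) * indicator {a. f a = c} a)"
    by (intro sum.mono_neutral_cong_left) auto
  finally show ?thesis by simp
qed

text \<open>For fixed \<open>x\<^sub>1 \<in> A\<^sub>1\<close> the injection \<open>r(\<cdot>, x\<^sub>1)\<close> maps \<open>A\<^sub>0\<close> onto the zeroth set of \<open>\<tau>'(A)\<close>,
  because both have the same cardinality.\<close>

lemma emeasure_fibre_measure_ca_head:
  fixes \<tau> :: "(nat \<Rightarrow> 'a::finite) \<Rightarrow> nat \<Rightarrow> 'a"
  assumes r: "\<And>x i. \<tau> x i = r (x i) (x (Suc i))" and bij: "\<And>a. bij (\<lambda>b. r b a)"
    and A: "\<And>i. A i \<noteq> {}" and card: "card (set_ca \<tau> A 0) = card (A 0)"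
    and E: "E \<in> sets full_shift"
  shows "emeasure (fibre_measure A) {x. r (x 0) (x 1) = c \<and> left_shift x \<in> E} =
    ennreal (pmf (pmf_of_set (set_ca \<tau> A 0)) c) * emeasure (fibre_measure (left_shift A)) E"
proof -
  let ?X = "{x. r (x 0) (x 1) = c \<and> left_shift x \<in> E}"
  have "?X = ((\<lambda>x. \<tau> x 0) -` {c} \<inter> space full_shift) \<inter> (left_shift -` E \<inter> space full_shift)"
    by (auto simp: r)
  also have "\<dots> \<in> sets full_shift"
    by (intro sets.Int measurable_sets[OF measurable_left_shift E]
        measurable_sets[OF measurable_compose[OF measurable_ca[of \<tau> r] measurable_shift_coord]]) (auto simp: r)
  finally have S: "?X \<in> sets full_shift" .
  have "emeasure (fibre_measure A) ?X = (\<integral>\<^sup>+x. indicator ?X x \<partial>fibre_measure A)"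
    using S by (subst nn_integral_indicator) auto
  also have "\<dots> = (\<Sum>a\<in>UNIV. ennreal (pmf (pmf_of_set (A 0)) a) *
      (\<integral>\<^sup>+y. indicator ?X (case_nat a y) \<partial>fibre_measure (left_shift A)))"
    using S by (intro nn_integral_fibre_measure_split) auto
  \<comment> \<open>Averaging over x_0 with the tail y frozen turns r into the fixed injection r(.,
    y 0).\<close>
  also have "\<dots> = (\<integral>\<^sup>+y. (\<Sum>a\<in>UNIV. ennreal (pmf (pmf_of_set (A 0)) a) * indicator ?X (case_nat a y))
      \<partial>fibre_measure (left_shift A))"
  proof -
    have [measurable]: "(\<lambda>y. indicator ?X (case_nat a y) :: ennreal) \<in> borel_measurable (fibre_measure (left_shift A))" for a
      using measurable_compose[OF measurable_case_nat, of "indicator ?X" borel a] S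
      by (simp add: measurable_cong_sets[OF sets_fibre_measure refl])
    show ?thesis
      by (subst nn_integral_sum, measurable, intro sum.cong refl nn_integral_cmult[symmetric]) measurable
  qed
  also have "\<dots> = (\<integral>\<^sup>+y. ennreal (pmf (pmf_of_set (set_ca \<tau> A 0)) c) * indicator E y
      \<partial>fibre_measure (left_shift A))"
  proof (rule nn_integral_cong_AE)
    have "AE y in fibre_measure (left_shift A). \<forall>i. y i \<in> left_shift A i"
      using A by (intro AE_fibre_measure_mem) (auto simp: left_shift_def)
    then show "AE y in fibre_measure (left_shift A).
      (\<Sum>a\<in>UNIV. ennreal (pmf (pmf_of_set (A 0)) a) * indicator ?X (case_nat a y)) =
      ennreal (pmf (pmf_of_set (set_ca \<tau> A 0)) c) * indicator E y"
    proof eventually_elim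
      fix y assume y: "\<forall>i. y i \<in> left_shift A i"
      have inj: "inj (\<lambda>b. r b (y 0))"
        using bij by (simp add: bij_def)
      have "(\<lambda>b. r b (y 0)) ` A 0 \<subseteq> set_ca \<tau> A 0"
        using y[rule_format, of 0] unfolding set_ca_eq[of \<tau> r A, OF r A] by (auto simp: left_shift_def)
      moreover have "card ((\<lambda>b. r b (y 0)) ` A 0) = card (set_ca \<tau> A 0)"
        using card inj by (subst card_image) (auto intro: inj_on_subset)
      ultimately have im: "(\<lambda>b. r b (y 0)) ` A 0 = set_ca \<tau> A 0"
        by (intro card_subset_eq) auto
      have "(\<Sum>a\<in>UNIV. ennreal (pmf (pmf_of_set (A 0)) a) * indicator ?X (case_nat a y)) =
        (\<Sum>a\<in>UNIV. ennreal (pmf (pmf_of_set (A 0)) a) * indicator {a. r a (y 0) = c} a) * indicator E y"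
        unfolding sum_distrib_right by (intro sum.cong refl) (auto split: split_indicator)
      then show "(\<Sum>a\<in>UNIV. ennreal (pmf (pmf_of_set (A 0)) a) * indicator ?X (case_nat a y)) =
        ennreal (pmf (pmf_of_set (set_ca \<tau> A 0)) c) * indicator E y"
        by (subst (asm) pmf_of_set_bij_image[OF inj A]) (simp add: im)
    qed
  qed
  also have "\<dots> = ennreal (pmf (pmf_of_set (set_ca \<tau> A 0)) c) * emeasure (fibre_measure (left_shift A)) E"
    using E by (intro nn_integral_cmult_indicator) simp
  finally show ?thesis .
qed

text \<open>By \<open>emeasure_fibre_measure_ca_head\<close>, the letter r(x_0, x_1) is uniform and
  independent of \<sigma>(x), although it depends on x_1. The remaining letters of the image are
  functions of \<sigma>(x), so the induction peels off one factor and continues with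
  \<open>left_shift A\<close>.\<close>

lemma distr_fibre_measure_ca:
  fixes \<tau> :: "(nat \<Rightarrow> 'a::finite) \<Rightarrow> nat \<Rightarrow> 'a"
  assumes r: "\<And>x i. \<tau> x i = r (x i) (x (Suc i))" and bij: "\<And>a. bij (\<lambda>b. r b a)"
    and A: "\<And>i. A i \<noteq> {}" and card: "\<And>i. card (set_ca \<tau> A i) = card (A i)"
  shows "distr (fibre_measure A) full_shift \<tau> = fibre_measure (set_ca \<tau> A)"
proof (rule measure_eqI_cyl)
  have m: "\<tau> \<in> measurable full_shift full_shift"
    using r by (rule measurable_ca)
  then have m': "\<tau> \<in> measurable (fibre_measure A) full_shift" for A
    by simp
  show "finite_measure (distr (fibre_measure A) full_shift \<tau>)"
    using prob_space.prob_space_distr[OF prob_space_fibre_measure m'] by (simp add: prob_space_def)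
  fix w
  show "emeasure (distr (fibre_measure A) full_shift \<tau>) (cyl w) = emeasure (fibre_measure (set_ca \<tau> A)) (cyl w)"
    using A card
  proof (induction w arbitrary: A)
    case Nil
    then show ?case
      by (simp add: emeasure_distr m' cyl_in_sets[of "[]", simplified])
  next
    case (Cons c v A)
    have shift: "set_ca \<tau> (left_shift A) = left_shift (set_ca \<tau> A)"
      using Cons.prems(1)
      by (intro ext) (simp add: set_ca_eq[of \<tau> r, OF r] left_shift_def)
    have "\<tau> -` cyl (c # v) = {x. r (x 0) (x 1) = c \<and> left_shift x \<in> \<tau> -` cyl v}"
    proof -
      have "left_shift (\<tau> x) = \<tau> (left_shift x)" for x
        by (simp add: left_shift_def r fun_eq_iff)
      then show ?thesis by (auto simp: r)
    qed
    moreover have "\<tau> -` cyl v \<in> sets full_shift"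
      using measurable_sets[OF m cyl_in_sets] by simp
    ultimately have "emeasure (distr (fibre_measure A) full_shift \<tau>) (cyl (c # v)) =
      ennreal (pmf (pmf_of_set (set_ca \<tau> A 0)) c) * emeasure (fibre_measure (left_shift A)) (\<tau> -` cyl v)"
      using emeasure_fibre_measure_ca_head[of \<tau> r A "\<tau> -` cyl v" c, OF r bij] Cons.prems
      by (simp add: emeasure_distr m')
    also have "emeasure (fibre_measure (left_shift A)) (\<tau> -` cyl v) =
        emeasure (fibre_measure (set_ca \<tau> (left_shift A))) (cyl v)"
      using Cons.IH[of "left_shift A"] Cons.prems
      by (simp add: emeasure_distr m' shift) (simp add: left_shift_def)
    finally show ?case
      by (simp add: shift emeasure_fibre_measure_cyl_Cons)
  qed
qed auto

lemma Z_D: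
  assumes "A \<in> Z \<tau>"
  shows "A i \<noteq> {}" "card (set_ca \<tau> A i) = card (A i)"
proof -
  obtain k where k: "1 \<le> k" "\<And>i. card (A i) = k" "\<And>n i. n > 0 \<Longrightarrow> card ((set_ca \<tau> ^^ n) A i) = k"
    using assms by (auto simp: Z_def Z_k_def)
  show "A i \<noteq> {}"
    using k(1) k(2)[of i] by (metis card.empty not_one_le_zero)
  show "card (set_ca \<tau> A i) = card (A i)"
    using k(2)[of i] k(3)[of 1 i] by simp
qed

lemma in_sets_pair_coord:
  "{p :: (nat \<Rightarrow> 'b::finite) \<times> (nat \<Rightarrow> 'c::finite). P (fst p i) (snd p j)} \<in> sets (full_shift \<Otimes>\<^sub>M full_shift)"
proof -
  have "{p :: (nat \<Rightarrow> 'b) \<times> (nat \<Rightarrow> 'c). P (fst p i) (snd p j)} =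
    (\<Union>(B, b)\<in>{(B, b). P B b}. ((\<lambda>p. fst p i) -` {B} \<inter> space (full_shift \<Otimes>\<^sub>M full_shift))
      \<inter> ((\<lambda>p. snd p j) -` {b} \<inter> space (full_shift \<Otimes>\<^sub>M full_shift)))"
    by (auto simp: space_pair_measure)
  also have "\<dots> \<in> sets (full_shift \<Otimes>\<^sub>M full_shift)"
    by (intro sets.finite_UN) (auto intro!: sets.Int
      measurable_sets[OF measurable_compose[OF measurable_fst measurable_shift_coord]]
      measurable_sets[OF measurable_compose[OF measurable_snd measurable_shift_coord]])
  finally show ?thesis .
qed

subsection \<open>The joint law of \<open>A\<close> and \<open>a\<close>\<close>

text \<open>The law of (A, a) as a pair of sequences rather than a sequence of pairs: \<nu> and
  \<mu> are then the marginals under \<open>fst\<close> and \<open>snd\<close>, and a letter can be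
  changed while A stays fixed.\<close>

definition joint_measure :: "(nat \<Rightarrow> 'a::finite set) measure \<Rightarrow> ((nat \<Rightarrow> 'a set) \<times> (nat \<Rightarrow> 'a)) measure" where
  "joint_measure \<nu> = \<nu> \<bind> (\<lambda>A. distr (fibre_measure A) (full_shift \<Otimes>\<^sub>M full_shift) (Pair A))"

lemma measurable_joint_kernel:
  assumes \<nu>: "sets \<nu> = sets full_shift"
  shows "(\<lambda>A. distr (fibre_measure A) (full_shift \<Otimes>\<^sub>M full_shift) (Pair A))
    \<in> measurable \<nu> (subprob_algebra (full_shift \<Otimes>\<^sub>M (full_shift :: (nat \<Rightarrow> 'a::finite) measure)))"
proof -
  have "(\<lambda>A. distr (fibre_measure A) (full_shift \<Otimes>\<^sub>M full_shift) (Pair A))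
    \<in> measurable full_shift (subprob_algebra (full_shift \<Otimes>\<^sub>M (full_shift :: (nat \<Rightarrow> 'a) measure)))"
    by (rule measurable_distr2[OF _ measurable_fibre_measure_subprob]) simp
  then show ?thesis
    by (simp add: measurable_cong_sets[OF \<nu> refl])
qed

context
  fixes \<nu> :: "(nat \<Rightarrow> 'a::finite set) measure"
  assumes sets_\<nu>: "sets \<nu> = sets full_shift" and prob_\<nu>: "prob_space \<nu>"
begin

interpretation \<nu>: prob_space \<nu> by (rule prob_\<nu>)

lemma space_\<nu>: "space \<nu> = UNIV"
  using sets_eq_imp_space_eq[OF sets_\<nu>] by simp

lemma sets_joint_measure: "sets (joint_measure \<nu>) = sets (full_shift \<Otimes>\<^sub>M full_shift)"
  unfolding joint_measure_def by (rule sets_bind) (auto simp: \<nu>.not_empty)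

lemma space_joint_measure: "space (joint_measure \<nu>) = UNIV"
  using sets_eq_imp_space_eq[OF sets_joint_measure] by (simp add: space_pair_measure)

lemma measurable_Pair_fibre:
  "Pair A \<in> measurable (fibre_measure A') (full_shift \<Otimes>\<^sub>M full_shift)"
  by simp

lemma nn_integral_joint_measure:
  assumes f: "f \<in> borel_measurable (full_shift \<Otimes>\<^sub>M full_shift)"
  shows "(\<integral>\<^sup>+p. f p \<partial>joint_measure \<nu>) = (\<integral>\<^sup>+A. \<integral>\<^sup>+x. f (A, x) \<partial>fibre_measure A \<partial>\<nu>)"
  unfolding joint_measure_def
  by (subst nn_integral_bind[OF f measurable_joint_kernel[OF sets_\<nu>]])
    (intro nn_integral_cong, subst nn_integral_distr[OF measurable_Pair_fibre], auto simp: f)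

lemma AE_joint_measure:
  assumes P: "{p. P p} \<in> sets (full_shift \<Otimes>\<^sub>M full_shift)"
  shows "(AE p in joint_measure \<nu>. P p) \<longleftrightarrow> (AE A in \<nu>. AE x in fibre_measure A. P (A, x))"
proof -
  have P': "Measurable.pred (full_shift \<Otimes>\<^sub>M full_shift) P"
    using P by (simp add: pred_def space_pair_measure)
  show ?thesis
    unfolding joint_measure_def
    by (subst AE_bind[OF measurable_joint_kernel[OF sets_\<nu>] P'])
      (intro AE_cong, subst AE_distr_iff[OF measurable_Pair_fibre], use P in \<open>auto simp: space_pair_measure\<close>)
qed

lemma prob_space_joint_measure: "prob_space (joint_measure \<nu>)"
proof
  have "emeasure (joint_measure \<nu>) (space (joint_measure \<nu>)) = (\<integral>\<^sup>+p. 1 \<partial>joint_measure \<nu>)"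
    by simp
  also have "\<dots> = (\<integral>\<^sup>+A. \<integral>\<^sup>+x. 1 \<partial>fibre_measure A \<partial>\<nu>)"
    by (subst nn_integral_joint_measure) auto
  also have "\<dots> = 1"
    using \<nu>.emeasure_space_1 by simp
  finally show "emeasure (joint_measure \<nu>) (space (joint_measure \<nu>)) = 1" .
qed

lemma measurable_joint_fst: "fst \<in> measurable (joint_measure \<nu>) full_shift"
  and measurable_joint_snd: "snd \<in> measurable (joint_measure \<nu>) full_shift"
  by (simp_all add: measurable_cong_sets[OF sets_joint_measure refl])

lemma distr_joint_fst: "distr (joint_measure \<nu>) full_shift fst = \<nu>"
proof (rule measure_eqI)
  fix E assume "E \<in> sets (distr (joint_measure \<nu>) full_shift fst)"
  then have E: "E \<in> sets full_shift" by simp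
  have "emeasure (distr (joint_measure \<nu>) full_shift fst) E = (\<integral>\<^sup>+A. indicator E A \<partial>distr (joint_measure \<nu>) full_shift fst)"
    using E by simp
  also have "\<dots> = (\<integral>\<^sup>+p. indicator E (fst p) \<partial>joint_measure \<nu>)"
    using E by (intro nn_integral_distr measurable_joint_fst) auto
  also have "\<dots> = (\<integral>\<^sup>+A. \<integral>\<^sup>+x. indicator E A \<partial>fibre_measure A \<partial>\<nu>)"
    using E by (subst nn_integral_joint_measure) auto
  also have "\<dots> = emeasure \<nu> E"
    using E by (simp add: sets_\<nu>)
  finally show "emeasure (distr (joint_measure \<nu>) full_shift fst) E = emeasure \<nu> E" .
qed (simp add: sets_\<nu>)

lemma measurable_fibre_\<nu>: "fibre_measure \<in> measurable \<nu> (subprob_algebra full_shift)"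
  by (simp add: measurable_cong_sets[OF sets_\<nu> refl])

lemma distr_joint_snd: "distr (joint_measure \<nu>) full_shift snd = \<nu> \<bind> fibre_measure"
  unfolding joint_measure_def
proof (subst distr_bind[OF measurable_joint_kernel[OF sets_\<nu>] \<nu>.not_empty measurable_snd], rule arg_cong[where f="bind \<nu>"], rule ext)
  fix A :: "nat \<Rightarrow> 'a set"
  show "distr (distr (fibre_measure A) (full_shift \<Otimes>\<^sub>M full_shift) (Pair A)) full_shift snd = fibre_measure A"
    by (subst distr_distr) (auto simp: comp_def intro: distr_id2)
qed

lemma finite_pointed_sets: "finite (pointed_sets :: ('a set \<times> 'a) set)"
  by simp

context
  assumes nonempty: "AE A in \<nu>. \<forall>i. A i \<noteq> {}"
begin

lemma AE_joint_mem: "AE p in joint_measure \<nu>. \<forall>i. snd p i \<in> fst p i"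
proof (subst AE_joint_measure)
  have "{p :: (nat \<Rightarrow> 'a set) \<times> (nat \<Rightarrow> 'a). \<forall>i. snd p i \<in> fst p i} = (\<Inter>i. {p. snd p i \<in> fst p i})"
    by auto
  also have "\<dots> \<in> sets (full_shift \<Otimes>\<^sub>M full_shift)"
    by (intro sets.countable_INT) (auto intro: in_sets_pair_coord)
  finally show "{p :: (nat \<Rightarrow> 'a set) \<times> (nat \<Rightarrow> 'a). \<forall>i. snd p i \<in> fst p i} \<in> sets (full_shift \<Otimes>\<^sub>M full_shift)" .
  show "AE A in \<nu>. AE x in fibre_measure A. \<forall>i. snd (A, x) i \<in> fst (A, x) i"
    using nonempty by eventually_elim (use AE_fibre_measure_mem in auto)
qed

text \<open>The value at \<open>i\<close> with \<open>a\<^sub>i \<notin> A\<^sub>i\<close> is irrelevant; it only keeps the map inside the alphabet.\<close>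

definition pointing :: "(nat \<Rightarrow> 'a set) \<times> (nat \<Rightarrow> 'a) \<Rightarrow> nat \<Rightarrow> 'a set \<times> 'a" where
  "pointing p = (\<lambda>i. if snd p i \<in> fst p i then (fst p i, snd p i) else (UNIV, undefined))"

lemma measurable_pointing: "pointing \<in> measurable (joint_measure \<nu>) (shift_space pointed_sets)"
proof (rule measurable_into_shift_space, subst measurable_count_space_eq2_countable, safe)
  fix i and B :: "'a set" and b :: 'a
  have "(\<lambda>p. pointing p i) -` {(B, b)} \<inter> space (joint_measure \<nu>) =
    {p. (\<lambda>C c. (if c \<in> C then (C, c) else (UNIV, undefined)) = (B, b)) (fst p i) (snd p i)}"
    by (auto simp: pointing_def space_joint_measure)
  then show "(\<lambda>p. pointing p i) -` {(B, b)} \<inter> space (joint_measure \<nu>) \<in> sets (joint_measure \<nu>)"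
    unfolding sets_joint_measure
    using in_sets_pair_coord[of "\<lambda>C c. (if c \<in> C then (C, c) else (UNIV, undefined)) = (B, b)" i i] by simp
qed (auto simp: pointing_def pointed_sets_def)

text \<open>As long as A runs through the cylinder of the prescribed sets, the fibre probability of
  the prescribed letters is the constant product of the 1 / |A_i|, which leaves the integral over
  \<nu>.\<close>

lemma emeasure_joint_cylinder:
  assumes "\<forall>i\<le>n. b i \<in> pointed_sets"
  shows "emeasure (distr (joint_measure \<nu>) (shift_space pointed_sets) pointing) (cylinder pointed_sets n b) =
    emeasure \<nu> (cylinder UNIV n (\<lambda>i. fst (b i))) / of_nat (\<Prod>i\<le>n. card (fst (b i)))"
proof -
  let ?B = "word (Suc n) (\<lambda>i. fst (b i))" and ?b = "word (Suc n) (\<lambda>i. snd (b i))"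
  have S: "cyl ?B \<times> cyl ?b \<in> sets (full_shift \<Otimes>\<^sub>M full_shift)"
    by (intro pair_measureI cyl_in_sets)
  have "emeasure (distr (joint_measure \<nu>) (shift_space pointed_sets) pointing) (cylinder pointed_sets n b) =
    emeasure (joint_measure \<nu>) (pointing -` cylinder pointed_sets n b \<inter> space (joint_measure \<nu>))"
    by (rule emeasure_distr[OF measurable_pointing cylinder_in_sets])
  \<comment> \<open>The two events differ only where \<open>pointing\<close> substitutes its default
    value, that is where some a_i lies outside A_i, a null set.\<close>
  also have "\<dots> = emeasure (joint_measure \<nu>) (cyl ?B \<times> cyl ?b)"
  proof (rule emeasure_eq_AE)
    show "AE p in joint_measure \<nu>. (p \<in> pointing -` cylinder pointed_sets n b \<inter> space (joint_measure \<nu>)) = (p \<in> cyl ?B \<times> cyl ?b)"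
      using AE_joint_mem
    proof eventually_elim
      case (elim p)
      then show ?case
        by (cases p) (auto simp: pointing_def space_joint_measure cylinder_def pointed_sets_def cyl_def word_eq_iff
            less_Suc_eq_le prod_eq_iff mem_Times_iff)
    qed
  qed (use measurable_sets[OF measurable_pointing cylinder_in_sets] S in \<open>auto simp: sets_joint_measure\<close>)
  also have "\<dots> = (\<integral>\<^sup>+p. indicator (cyl ?B \<times> cyl ?b) p \<partial>joint_measure \<nu>)"
    using S by (simp add: sets_joint_measure)
  also have "\<dots> = (\<integral>\<^sup>+A. \<integral>\<^sup>+x. indicator (cyl ?B \<times> cyl ?b) (A, x) \<partial>fibre_measure A \<partial>\<nu>)"
    using S by (intro nn_integral_joint_measure) auto
  also have "\<dots> = (\<integral>\<^sup>+A. (\<Prod>i<Suc n. ennreal (1 / card (fst (b i)))) * indicator (cyl ?B) A \<partial>\<nu>)"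
  proof (rule nn_integral_cong)
    fix A
    have "(\<integral>\<^sup>+x. indicator (cyl ?B \<times> cyl ?b) (A, x) \<partial>fibre_measure A) =
      (\<integral>\<^sup>+x. indicator (cyl ?B) A * indicator (cyl ?b) x \<partial>fibre_measure A)"
      by (intro nn_integral_cong) (auto split: split_indicator)
    also have "\<dots> = indicator (cyl ?B) A * emeasure (fibre_measure A) (cyl ?b)"
      by (intro nn_integral_cmult_indicator) (simp add: cyl_in_sets)
    also have "\<dots> = (\<Prod>i<Suc n. ennreal (1 / card (fst (b i)))) * indicator (cyl ?B) A"
    proof (cases "A \<in> cyl ?B")
      case True
      then have A: "A i = fst (b i)" "snd (b i) \<in> fst (b i)" if "i < Suc n" for i
        using that assms by (auto simp: cyl_def word_eq_iff pointed_sets_def case_prod_beta less_Suc_eq_le)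
      have "emeasure (fibre_measure A) (cyl ?b) = (\<Prod>i<Suc n. ennreal (pmf (pmf_of_set (A i)) (snd (b i))))"
        unfolding emeasure_fibre_measure_cyl length_word by (intro prod.cong refl) (simp add: nth_word)
      also have "\<dots> = (\<Prod>i<Suc n. ennreal (1 / card (fst (b i))))"
      proof (intro prod.cong refl)
        fix i assume i: "i \<in> {..<Suc n}"
        then show "ennreal (pmf (pmf_of_set (A i)) (snd (b i))) = ennreal (1 / card (fst (b i)))"
          using A[of i] by (subst pmf_of_set) auto
      qed
      finally show ?thesis using True by simp
    qed simp
    finally show "(\<integral>\<^sup>+x. indicator (cyl ?B \<times> cyl ?b) (A, x) \<partial>fibre_measure A) =
      (\<Prod>i<Suc n. ennreal (1 / card (fst (b i)))) * indicator (cyl ?B) A" .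
  qed
  also have "\<dots> = (\<Prod>i<Suc n. ennreal (1 / card (fst (b i)))) * emeasure \<nu> (cyl ?B)"
    by (intro nn_integral_cmult_indicator) (simp add: sets_\<nu> cyl_in_sets)
  also have "(\<Prod>i<Suc n. ennreal (1 / card (fst (b i)))) = 1 / of_nat (\<Prod>i\<le>n. card (fst (b i)))"
  proof -
    have "card (fst (b i)) > 0" if "i \<le> n" for i
      using assms that by (auto simp: pointed_sets_def card_gt_0_iff dest!: spec[of _ i])
    then have "0 < (\<Prod>i\<le>n. card (fst (b i)))"
      by (intro prod_pos) auto
    moreover have "(\<Prod>i<Suc n. ennreal (1 / card (fst (b i)))) = ennreal (1 / real (\<Prod>i\<le>n. card (fst (b i))))"
      by (subst prod_ennreal) (auto simp: lessThan_Suc_atMost prod_dividef)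
    ultimately show ?thesis
      by (simp add: divide_ennreal[symmetric] ennreal_of_nat_eq_real_of_nat del: of_nat_prod)
  qed
  finally show ?thesis
    by (simp add: cylinder_eq_cyl ennreal_times_divide mult.commute)
qed

text \<open>The definite description needs both halves: the joint law meets the requirement, and a
  measure meeting it agrees with this law on all cylinders, where the values are finite.\<close>

lemma tilde_measure_eq:
  "tilde_measure \<nu> = distr (joint_measure \<nu>) (shift_space pointed_sets) pointing" (is "_ = ?D")
  unfolding tilde_measure_def
proof (rule the_equality, safe)
  fix M :: "(nat \<Rightarrow> 'a set \<times> 'a) measure"
  assume M: "sets M = sets (shift_space pointed_sets)"
    "\<forall>n b. (\<forall>i\<le>n. b i \<in> pointed_sets) \<longrightarrow> emeasure M (cylinder pointed_sets n b) =
        emeasure \<nu> (cylinder UNIV n (\<lambda>i. fst (b i))) / of_nat (\<Prod>i\<le>n. card (fst (b i)))"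
  interpret J: prob_space ?D
    by (rule prob_space.prob_space_distr[OF prob_space_joint_measure measurable_pointing])
  show "M = ?D"
  proof (rule measure_eqI_cylinder[OF finite_pointed_sets M(1)])
    fix n and b :: "nat \<Rightarrow> 'a set \<times> 'a"
    assume b: "\<forall>i\<le>n. b i \<in> pointed_sets"
    show eq: "emeasure M (cylinder pointed_sets n b) = emeasure ?D (cylinder pointed_sets n b)"
      using M(2)[rule_format, of n b] b emeasure_joint_cylinder[OF b] by auto
    show "emeasure M (cylinder pointed_sets n b) \<noteq> \<infinity>"
      unfolding eq by (simp del: emeasure_distr)
  qed simp
qed (simp_all del: of_nat_prod add: emeasure_joint_cylinder)

lemma projected_measure_eq: "projected_measure \<nu> = \<nu> \<bind> fibre_measure"
proof -
  have m: "psi2 \<in> measurable (shift_space pointed_sets) full_shift"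
    unfolding psi2_def
    by (intro measurable_into_full_shift measurable_compose[OF measurable_shift_coord]) simp
  have "projected_measure \<nu> = distr (joint_measure \<nu>) full_shift (psi2 \<circ> pointing)"
    unfolding projected_measure_def tilde_measure_eq by (rule distr_distr[OF m measurable_pointing])
  also have "\<dots> = distr (joint_measure \<nu>) full_shift snd"
  proof (rule distr_cong_AE)
    show "AE p in joint_measure \<nu>. (psi2 \<circ> pointing) p = snd p"
      using AE_joint_mem by eventually_elim (auto simp: psi2_def pointing_def)
  qed (auto intro: measurable_comp[OF measurable_pointing m] measurable_joint_snd)
  finally show ?thesis by (simp add: distr_joint_snd)
qed

end

end

subsection \<open>Invariance and ergodicity\<close>

lemma sets_bind_fibre:
  assumes "sets \<nu> = sets full_shift" "prob_space \<nu>"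
  shows "sets (\<nu> \<bind> fibre_measure) = sets (full_shift :: (nat \<Rightarrow> 'a::finite) measure)"
  using prob_space.not_empty[OF assms(2)] by (intro sets_bind) auto

lemma space_bind_fibre:
  fixes \<nu> :: "(nat \<Rightarrow> 'a::finite set) measure"
  assumes "sets \<nu> = sets full_shift" "prob_space \<nu>"
  shows "space (\<nu> \<bind> fibre_measure) = UNIV"
  using sets_eq_imp_space_eq[OF sets_bind_fibre[OF assms]] by simp

lemma prob_space_bind_fibre:
  fixes \<nu> :: "(nat \<Rightarrow> 'a::finite set) measure"
  assumes "sets \<nu> = sets full_shift" "prob_space \<nu>"
  shows "prob_space (\<nu> \<bind> fibre_measure)"
  using prob_space.prob_space_bind[OF assms(2) _ measurable_fibre_\<nu>[OF assms]] prob_space_fibre_measure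
  by auto

lemma AE_bind_fibre:
  fixes \<nu> :: "(nat \<Rightarrow> 'a::finite set) measure"
  assumes "sets \<nu> = sets full_shift" "prob_space \<nu>" and P: "{x. P x} \<in> sets full_shift"
  shows "(AE x in \<nu> \<bind> fibre_measure. P x) \<longleftrightarrow> (AE A in \<nu>. AE x in fibre_measure A. P x)"
  using P by (intro AE_bind[OF measurable_fibre_\<nu>[OF assms(1,2)]]) (simp add: pred_def)

text \<open>If T carries the fibre over A to the fibre over S(A), then T carries the mixture over
  \<nu> to the mixture over the image of \<nu> under S, which is \<nu> again. Used for both the
  shift and \<tau>.\<close>

lemma invariant_measure_bind_fibre:
  fixes \<nu> :: "(nat \<Rightarrow> 'a::finite set) measure"
  assumes \<nu>: "sets \<nu> = sets full_shift" "prob_space \<nu>"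
    and T: "T \<in> measurable full_shift full_shift" and S: "invariant_measure \<nu> S"
    and eq: "AE A in \<nu>. distr (fibre_measure A) full_shift T = fibre_measure (S A)"
  shows "invariant_measure (\<nu> \<bind> fibre_measure) T"
proof -
  note [simp] = sets_bind_fibre[OF \<nu>]
  note ne = prob_space.not_empty[OF \<nu>(2)]
  have S': "S \<in> measurable \<nu> full_shift" "distr \<nu> full_shift S = \<nu>"
    using S distr_cong[of \<nu> \<nu> full_shift \<nu> S S] by (auto simp: invariant_measure_def measurable_cong_sets[OF refl \<nu>(1)] \<nu>(1))
  have "distr (\<nu> \<bind> fibre_measure) (\<nu> \<bind> fibre_measure) T = distr (\<nu> \<bind> fibre_measure) full_shift T"
    by (intro distr_cong) auto
  also have "\<dots> = \<nu> \<bind> (\<lambda>A. distr (fibre_measure A) full_shift T)"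
    by (rule distr_bind[OF measurable_fibre_\<nu>[OF \<nu>] ne T])
  also have "\<dots> = \<nu> \<bind> (\<lambda>A. fibre_measure (S A))"
    by (rule bind_cong_AE[OF refl measurable_compose[OF measurable_fibre_\<nu>[OF \<nu>] measurable_distr[OF T]]
          measurable_compose[OF S'(1) measurable_fibre_measure_subprob] eq])
  also have "\<dots> = distr \<nu> full_shift S \<bind> fibre_measure"
    by (rule bind_distr[OF S'(1) measurable_fibre_measure_subprob ne, symmetric])
  finally show ?thesis
    using T unfolding invariant_measure_def S'(2) by (simp cong: measurable_cong_sets)
qed

section \<open>Zero-one law in the fibres and ergodicity\<close>

lemma emeasure_fibre_measure_cyl_Int:
  fixes A :: "nat \<Rightarrow> 'a::finite set"
  assumes E: "E \<in> sets full_shift"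
  shows "emeasure (fibre_measure A) (cyl w \<inter> (left_shift ^^ length w) -` E) =
    emeasure (fibre_measure A) (cyl w) * emeasure (fibre_measure ((left_shift ^^ length w) A)) E"
proof (induction w arbitrary: A)
  case (Cons a v)
  have m: "(left_shift ^^ n) \<in> measurable (full_shift :: (nat \<Rightarrow> 'a) measure) full_shift" for n
    by (rule measurable_compose_n[OF measurable_left_shift])
  have "cyl (a # v) \<inter> (left_shift ^^ length (a # v)) -` E =
    {x. x 0 = a \<and> left_shift x \<in> cyl v \<inter> (left_shift ^^ length v) -` E}"
    by (auto simp: funpow_Suc_right simp del: funpow.simps)
  moreover have "cyl v \<inter> (left_shift ^^ length v) -` E \<in> sets full_shift"
    using measurable_sets[OF m E] cyl_in_sets by (intro sets.Int) auto
  ultimately have "emeasure (fibre_measure A) (cyl (a # v) \<inter> (left_shift ^^ length (a # v)) -` E) =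
      ennreal (pmf (pmf_of_set (A 0)) a) * (emeasure (fibre_measure (left_shift A)) (cyl v) *
        emeasure (fibre_measure ((left_shift ^^ length v) (left_shift A))) E)"
    by (simp only: emeasure_fibre_measure_Int Cons.IH)
  then show ?case
    by (simp only: emeasure_fibre_measure_cyl_Cons mult.assoc funpow_Suc_right comp_def list.size add_0_right add_Suc_right)
qed simp

lemma emeasure_fibre_measure_shift:
  fixes A :: "nat \<Rightarrow> 'a::finite set"
  assumes E: "E \<in> sets full_shift"
  shows "emeasure (fibre_measure A) ((left_shift ^^ n) -` E) = emeasure (fibre_measure ((left_shift ^^ n) A)) E"
  using E
proof (induction n arbitrary: E)
  case (Suc n)
  have "left_shift -` E \<in> sets full_shift"
    using measurable_sets[OF measurable_left_shift Suc.prems] by simp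
  moreover have "(left_shift ^^ Suc n) -` E = (left_shift ^^ n) -` (left_shift -` E)"
    by auto
  ultimately have "emeasure (fibre_measure A) ((left_shift ^^ Suc n) -` E) =
      emeasure (fibre_measure ((left_shift ^^ n) A)) (left_shift -` E)"
    using Suc.IH by simp
  also have "\<dots> = emeasure (distr (fibre_measure ((left_shift ^^ n) A)) full_shift left_shift) E"
    using Suc.prems by (subst emeasure_distr) auto
  finally show ?case
    by (simp only: distr_fibre_measure_left_shift funpow.simps comp_def)
qed simp

text \<open>A shift-invariant event is independent of every cylinder, hence of itself.\<close>

lemma fibre_measure_zero_one:
  fixes A :: "nat \<Rightarrow> 'a::finite set"
  assumes E: "E \<in> sets full_shift"
    and inv: "\<And>n. AE x in fibre_measure A. (left_shift ^^ n) x \<in> E \<longleftrightarrow> x \<in> E"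
  shows "emeasure (fibre_measure A) E = 0 \<or> emeasure (fibre_measure A) E = 1"
proof -
  interpret prob_space "fibre_measure A" by (rule prob_space_fibre_measure)
  have m: "(left_shift ^^ n) \<in> measurable (full_shift :: (nat \<Rightarrow> 'a) measure) full_shift" for n
    by (rule measurable_compose_n[OF measurable_left_shift])
  have V: "(left_shift ^^ n) -` E \<in> sets full_shift" for n
    using measurable_sets[OF m E] by simp
  have "emeasure (fibre_measure A) (cyl w \<inter> E) = emeasure (fibre_measure A) (cyl w) * emeasure (fibre_measure A) E" for w
  proof -
    \<comment> \<open>K_A need not be shift invariant, which is why the hypothesis covers all
      iterates under this one measure. Replacing E by its preimage under \<open>length w\<close>
      shifts removes any dependence on the letters of w.\<close>
    have "emeasure (fibre_measure A) (cyl w \<inter> E) = emeasure (fibre_measure A) (cyl w \<inter> (left_shift ^^ length w) -` E)"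
      using inv[of "length w"] V E cyl_in_sets[of w] by (intro emeasure_eq_AE) auto
    also have "\<dots> = emeasure (fibre_measure A) (cyl w) * emeasure (fibre_measure A) ((left_shift ^^ length w) -` E)"
      by (simp add: emeasure_fibre_measure_cyl_Int[OF E] emeasure_fibre_measure_shift[OF E])
    also have "emeasure (fibre_measure A) ((left_shift ^^ length w) -` E) = emeasure (fibre_measure A) E"
      using inv[of "length w"] V E by (intro emeasure_eq_AE) auto
    finally show ?thesis .
  qed
  \<comment> \<open>Agreement on cylinders extends to all events; evaluation at E itself gives P(E)
    = P(E) P(E).\<close>
  then have "density (fibre_measure A) (indicator E) = scale_measure (emeasure (fibre_measure A) E) (fibre_measure A)"
    using E cyl_in_sets emeasure_finite[of E]
    by (intro measure_eqI_cyl finite_measureI)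
      (auto simp: emeasure_density nn_integral_indicator' Int_commute mult.commute sets.top[of full_shift, simplified]
        simp flip: indicator_inter_arith)
  then have "emeasure (density (fibre_measure A) (indicator E)) E = emeasure (fibre_measure A) E * emeasure (fibre_measure A) E"
    using E by simp
  then have "emeasure (fibre_measure A) E = emeasure (fibre_measure A) E * emeasure (fibre_measure A) E"
    using E by (simp add: emeasure_density flip: indicator_inter_arith)
  then have "prob E = prob E * prob E"
    by (simp add: emeasure_eq_measure flip: ennreal_mult'')
  then show ?thesis
    by (auto simp: emeasure_eq_measure)
qed

lemma jointly_ergodic_bind_fibre:
  fixes \<nu> :: "(nat \<Rightarrow> 'a::finite set) measure"
  assumes \<nu>: "sets \<nu> = sets full_shift" "prob_space \<nu>"
    and inv: "invariant_measure \<nu> left_shift"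
    and T: "T \<in> measurable full_shift full_shift"
    and eq: "AE A in \<nu>. distr (fibre_measure A) full_shift T = fibre_measure (S A)"
    and erg: "jointly_ergodic \<nu> {left_shift, S}"
  shows "jointly_ergodic (\<nu> \<bind> fibre_measure) {left_shift, T}"
  unfolding jointly_ergodic_def
proof (intro ballI impI)
  let ?\<mu> = "\<nu> \<bind> fibre_measure"
  interpret \<nu>: prob_space \<nu> by fact
  fix E assume "E \<in> sets ?\<mu>" and *: "\<forall>U\<in>{left_shift, T}. AE x in ?\<mu>. (U x \<in> E) = (x \<in> E)"
  then have E: "E \<in> sets full_shift"
    by (simp add: sets_bind_fibre[OF \<nu>])
  note sp = space_bind_fibre[OF \<nu>]
  have set: "{x. (U x \<in> E) = (x \<in> E)} \<in> sets full_shift" if "U \<in> measurable full_shift full_shift" for U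
  proof -
    have "{x. (U x \<in> E) = (x \<in> E)} = ((U -` E \<inter> space full_shift) \<inter> E) \<union> (space full_shift - ((U -` E \<inter> space full_shift) \<union> E))"
      by auto
    also have "\<dots> \<in> sets full_shift"
      by (intro sets.Un sets.Int sets.Diff measurable_sets[OF that] E sets.top)
    finally show ?thesis .
  qed
  have m: "(left_shift ^^ n) \<in> measurable (full_shift :: (nat \<Rightarrow> 'a) measure) full_shift" for n
    by (rule measurable_compose_n[OF measurable_left_shift])
  have fib: "AE A in \<nu>. AE x in fibre_measure A. (U x \<in> E) = (x \<in> E)"
    if "U \<in> measurable full_shift full_shift" "AE x in ?\<mu>. (U x \<in> E) = (x \<in> E)" for U
    using AE_bind_fibre[OF \<nu> set[OF that(1)]] that(2) by simp
  have "invariant_measure ?\<mu> left_shift"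
    using invariant_measure_bind_fibre[OF \<nu> measurable_left_shift inv] distr_fibre_measure_left_shift by auto
  then have inv': "left_shift \<in> measurable ?\<mu> ?\<mu>" "distr ?\<mu> ?\<mu> left_shift = ?\<mu>"
    by (auto simp: invariant_measure_def)
  \<comment> \<open>E is invariant under one shift only up to a null set; invariance of the mixture
    pulls this null set back to a null set under each iterate.\<close>
  have "AE x in ?\<mu>. ((left_shift ^^ n) x \<in> E) = (x \<in> E)" for n
  proof (induction n)
    case (Suc n)
    then have "AE x in ?\<mu>. ((left_shift ^^ n) (left_shift x) \<in> E) = (left_shift x \<in> E)"
      by (intro AE_distrD[OF inv'(1)]) (simp only: inv'(2))
    moreover have "AE x in ?\<mu>. (left_shift x \<in> E) = (x \<in> E)"
      using * by simp
    ultimately show ?case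
      by eventually_elim (simp add: funpow_swap1)
  qed simp
  then have "AE A in \<nu>. \<forall>n. AE x in fibre_measure A. ((left_shift ^^ n) x \<in> E) = (x \<in> E)"
    unfolding AE_all_countable using fib[OF m] by auto
  then have zo: "AE A in \<nu>. emeasure (fibre_measure A) E = 0 \<or> emeasure (fibre_measure A) E = 1"
    by eventually_elim (use fibre_measure_zero_one[OF E] in blast)
  \<comment> \<open>The event of the base from which E comes: up to a null set, E consists of the
    full fibres over D.\<close>
  define D where "D = {A. emeasure (fibre_measure A) E = 1}"
  have eE: "(\<lambda>A. emeasure (fibre_measure A) E) \<in> borel_measurable \<nu>"
    using measurable_emeasure_kernel[OF measurable_fibre_\<nu>[OF \<nu>] E] .
  have D: "D \<in> sets \<nu>"
    using measurable_sets[OF eE, of "{1}"] by (simp add: D_def vimage_def space_\<nu>[OF \<nu>])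
  \<comment> \<open>Intertwining equates the probability of E in the fibre over V(A) with that of
    the preimage of E in the fibre over A, and this preimage equals E almost surely there.\<close>
  have key: "AE A in \<nu>. V A \<in> D \<longleftrightarrow> A \<in> D"
    if U: "U \<in> measurable full_shift full_shift" "AE x in ?\<mu>. (U x \<in> E) = (x \<in> E)"
      and V: "AE A in \<nu>. distr (fibre_measure A) full_shift U = fibre_measure (V A)" for U V
    using fib[OF U] V
  proof eventually_elim
    case (elim A)
    have "emeasure (fibre_measure (V A)) E = emeasure (fibre_measure A) (U -` E)"
      using E U(1) by (subst elim(2)[symmetric], subst emeasure_distr) auto
    also have "\<dots> = emeasure (fibre_measure A) E"
      using elim(1) E measurable_sets[OF U(1) E] by (intro emeasure_eq_AE) auto
    finally show ?case by (simp add: D_def)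
  qed
  have "measure \<nu> D = 0 \<or> measure \<nu> D = 1"
  proof -
    have "AE A in \<nu>. left_shift A \<in> D \<longleftrightarrow> A \<in> D"
      using * distr_fibre_measure_left_shift by (intro key[OF measurable_left_shift]) auto
    moreover have "AE A in \<nu>. S A \<in> D \<longleftrightarrow> A \<in> D"
      using * eq by (intro key[OF T]) auto
    ultimately show ?thesis
      using erg D unfolding jointly_ergodic_def by blast
  qed
  moreover have "emeasure ?\<mu> E = emeasure \<nu> D"
  proof -
    have "emeasure ?\<mu> E = (\<integral>\<^sup>+A. emeasure (fibre_measure A) E \<partial>\<nu>)"
      by (rule emeasure_bind[OF \<nu>.not_empty measurable_fibre_\<nu>[OF \<nu>] E])
    also have "\<dots> = (\<integral>\<^sup>+A. indicator D A \<partial>\<nu>)"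
      by (rule nn_integral_cong_AE) (use zo in \<open>eventually_elim, auto simp: D_def\<close>)
    finally show ?thesis using D by simp
  qed
  ultimately show "measure ?\<mu> E = 0 \<or> measure ?\<mu> E = 1"
    by (simp add: measure_def)
qed

subsection \<open>Block entropies\<close>

text \<open>H_n, summed over words instead of the blocks of a join, so that words can be extended at
  either end.\<close>

definition block_entropy :: "(nat \<Rightarrow> 'b::finite) measure \<Rightarrow> nat \<Rightarrow> real" where
  "block_entropy M n = - (\<Sum>w | length w = n. measure M (cyl w) * ln (measure M (cyl w)))"

lemma finite_words [simp]: "finite {w :: 'b::finite list. length w = n}"
  using finite_lists_length_eq[of "UNIV :: 'b set" n] by simp

lemma sum_words_Cons:
  "(\<Sum>w :: 'b::finite list | length w = Suc n. f w) = (\<Sum>w | length w = n. \<Sum>a\<in>UNIV. (f (a # w) :: real))"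
proof -
  have "(\<Sum>w :: 'b list | length w = Suc n. f w) = (\<Sum>(w, a)\<in>{w. length w = n} \<times> UNIV. f (a # w))"
    by (rule sum.reindex_bij_witness[where j="\<lambda>w. (tl w, hd w)" and i="\<lambda>(w, a). a # w"])
      (auto simp: length_Suc_conv)
  then show ?thesis
    by (simp add: sum.cartesian_product)
qed

lemma sum_words_snoc:
  "(\<Sum>w :: 'b::finite list | length w = Suc n. f w) = (\<Sum>w | length w = n. \<Sum>a\<in>UNIV. (f (w @ [a]) :: real))"
proof -
  have "(\<Sum>w :: 'b list | length w = Suc n. f w) = (\<Sum>(w, a)\<in>{w. length w = n} \<times> UNIV. f (w @ [a]))"
    by (rule sum.reindex_bij_witness[where j="\<lambda>w. (butlast w, last w)" and i="\<lambda>(w, a). w @ [a]"])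
      (auto simp: length_Suc_conv_rev)
  then show ?thesis
    by (simp add: sum.cartesian_product)
qed

lemma cyl_nonempty: "\<exists>x. x \<in> cyl w"
  by (rule exI[of _ "\<lambda>i. w ! i"]) (auto simp: cyl_def word_def map_nth)

lemma inj_on_cyl: "inj_on cyl {w. length w = n}"
proof (rule inj_onI)
  fix v w :: "'a list" assume "v \<in> {w. length w = n}" "w \<in> {w. length w = n}" "cyl v = cyl w"
  then show "v = w"
    using cyl_nonempty[of v] by (auto simp: cyl_def)
qed

lemma iterated_join_coordinates:
  fixes \<nu> :: "(nat \<Rightarrow> 'b::finite) measure"
  assumes "space \<nu> = UNIV"
  shows "iterated_join \<nu> left_shift (range (\<lambda>b. {x. x 0 = b})) n = cyl ` {w. length w = n}"
proof -
  define Q :: "nat \<Rightarrow> (nat \<Rightarrow> 'b) set set" where "Q i = range (\<lambda>b. {x. x i = b})" for i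
  have "(\<lambda>A. (left_shift ^^ i) -` A \<inter> space \<nu>) ` range (\<lambda>b. {x. x 0 = b}) = Q i" for i
    unfolding Q_def image_image assms by (auto simp: vimage_def left_shift_funpow)
  then have J: "iterated_join \<nu> left_shift (range (\<lambda>b. {x. x 0 = b})) n = common_refinement (Q ` {..<n})"
    by (simp add: iterated_join_def)
  \<comment> \<open>A block of \<open>Q i\<close> is a level set of coordinate i, hence fixed by any
    one of its points; a nonempty intersection of blocks is therefore determined by a single
    point.\<close>
  have Q: "C = {y. y i = x i}" if "C \<in> Q i" "x \<in> C" for C i x
    using that by (auto simp: Q_def)
  have cyl: "(\<Inter>i<n. {y. y i = x i}) = cyl (word n x)" for x :: "nat \<Rightarrow> 'b"
    by (auto simp: cyl_def word_eq_iff)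
  show ?thesis
    unfolding J
  proof (intro set_eqI iffI)
    fix X assume "X \<in> common_refinement (Q ` {..<n})"
    then obtain f x where f: "f \<in> (\<Pi> P\<in>Q ` {..<n}. P)" and X: "X = \<Inter> (f ` Q ` {..<n})" and x: "x \<in> X"
      unfolding common_refinement by auto
    have "f (Q i) = {y. y i = x i}" if "i < n" for i
      using f x that unfolding X by (intro Q) auto
    then have "X = (\<Inter>i<n. {y. y i = x i})"
      unfolding X by auto
    then show "X \<in> cyl ` {w. length w = n}"
      unfolding cyl by auto
  next
    fix X :: "(nat \<Rightarrow> 'b) set" assume "X \<in> cyl ` {w. length w = n}"
    then obtain w where w: "X = cyl w" "n = length w"
      by auto
    obtain x where x: "x \<in> cyl w"
      using cyl_nonempty by blast
    \<comment> \<open>Choice functions for a common refinement are indexed by the partitions, not by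
      i, and over a one-letter alphabet all \<open>Q i\<close> coincide. So f is defined from the
      partition and the point x alone.\<close>
    define f where "f P = (SOME C. C \<in> P \<and> x \<in> C)" for P :: "(nat \<Rightarrow> 'b) set set"
    have f: "f (Q i) \<in> Q i \<and> x \<in> f (Q i)" for i
      unfolding f_def by (rule someI[of _ "{y. y i = x i}"]) (auto simp: Q_def)
    then have "\<Inter> (f ` Q ` {..<n}) = (\<Inter>i<n. {y. y i = x i})"
      using Q[of "f (Q i)" i x for i] by auto
    also have "\<dots> = X"
      unfolding cyl using x by (simp add: cyl_def w)
    finally show "X \<in> common_refinement (Q ` {..<n})"
      unfolding common_refinement using f x w(1) by (auto intro!: bexI[of _ f])
  qed
qed

lemma partition_entropy_coordinates:
  fixes \<nu> :: "(nat \<Rightarrow> 'b::finite) measure"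
  assumes "space \<nu> = UNIV"
  shows "partition_entropy \<nu> (iterated_join \<nu> left_shift (range (\<lambda>b. {x. x 0 = b})) n) = block_entropy \<nu> n"
  unfolding partition_entropy_def block_entropy_def iterated_join_coordinates[OF assms]
  by (subst sum.reindex[OF inj_on_cyl]) simp

section \<open>Block entropies of a stationary process\<close>

locale shift_measure = prob_space M for M :: "(nat \<Rightarrow> 'b::finite) measure" +
  assumes sets_M: "sets M = sets full_shift" and invariant: "invariant_measure M left_shift"
begin

lemma space_M: "space M = UNIV"
  using sets_eq_imp_space_eq[OF sets_M] by simp

lemma cyl_events: "cyl w \<in> events"
  by (simp add: sets_M cyl_in_sets)

lemma prob_left_shift: "E \<in> events \<Longrightarrow> prob (left_shift -` E) = prob E"
  using invariant measure_distr[of left_shift M M E] by (simp add: invariant_measure_def space_M)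

lemma prob_cyl_le_1: "prob (cyl w) \<le> 1"
  by (rule prob_le_1)

text \<open>Extending a word to the left preserves the total mass because of shift invariance;
  extension to the right, below, is mere additivity.\<close>

lemma sum_prob_cyl_Cons: "(\<Sum>a\<in>UNIV. prob (cyl (a # w))) = prob (cyl w)"
proof -
  have "(\<Sum>a\<in>UNIV. prob (cyl (a # w))) = prob (\<Union>a. cyl (a # w))"
    by (rule finite_measure_finite_Union[symmetric]) (auto simp: cyl_events disjoint_family_on_def)
  also have "(\<Union>a. cyl (a # w)) = left_shift -` cyl w"
    by auto
  finally show ?thesis
    by (simp add: prob_left_shift cyl_events)
qed

lemma cyl_snoc: "x \<in> cyl (w @ [a]) \<longleftrightarrow> x \<in> cyl w \<and> x (length w) = a"
  by (auto simp: cyl_def word_def)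

lemma sum_prob_cyl_snoc: "(\<Sum>a\<in>UNIV. prob (cyl (w @ [a]))) = prob (cyl w)"
proof -
  have "(\<Sum>a\<in>UNIV. prob (cyl (w @ [a]))) = prob (\<Union>a. cyl (w @ [a]))"
    by (rule finite_measure_finite_Union[symmetric]) (auto simp: cyl_events disjoint_family_on_def cyl_snoc)
  also have "(\<Union>a. cyl (w @ [a])) = cyl w"
    by (auto simp: cyl_snoc)
  finally show ?thesis .
qed

lemma block_entropy_0 [simp]: "block_entropy M 0 = 0"
proof -
  have "{w :: 'b list. length w = 0} = {[]}" by auto
  then show ?thesis using prob_space by (simp add: block_entropy_def space_M)
qed

lemma block_entropy_nonneg: "0 \<le> block_entropy M n"
proof -
  have "prob (cyl w) * ln (prob (cyl w)) \<le> 0" for w :: "'b list"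
    using prob_cyl_le_1[of w] by (cases "prob (cyl w) = 0") (auto intro!: mult_nonneg_nonpos simp: zero_less_measure_iff)
  then show ?thesis
    by (auto simp: block_entropy_def intro: sum_nonpos)
qed

text \<open>Strong subadditivity, from \<open>ln t \<ge> 1 - 1/t\<close> with \<open>t\<close> the ratio of \<open>p(awb) p(w)\<close> to \<open>p(aw) p(wb)\<close>.\<close>

lemma block_entropy_concave:
  "block_entropy M (Suc (Suc n)) + block_entropy M n \<le> 2 * block_entropy M (Suc n)"
proof -
  define p where "p w = prob (cyl w)" for w
  have pos: "0 \<le> p w" for w
    by (simp add: p_def)
  have le1: "p (a # w) \<le> p w" for a w
    using sum_prob_cyl_Cons[of w] member_le_sum[of a UNIV "\<lambda>a. p (a # w)"] pos by (simp add: p_def)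
  have le2: "p (w @ [a]) \<le> p w" for a w
    using sum_prob_cyl_snoc[of w] member_le_sum[of a UNIV "\<lambda>a. p (w @ [a])"] pos by (simp add: p_def)
  let ?S = "\<lambda>f. \<Sum>w | length w = n. \<Sum>a\<in>UNIV. \<Sum>b\<in>UNIV. (f a w b :: real)"
  have sum1: "(\<Sum>a\<in>UNIV. p (a # w)) = p w" and sum2: "(\<Sum>a\<in>UNIV. p (w @ [a])) = p w" for w
    by (simp_all add: p_def sum_prob_cyl_Cons sum_prob_cyl_snoc)
  have sum2': "(\<Sum>b\<in>UNIV. p (a # w @ [b])) = p (a # w)" for a w
    using sum2[of "a # w"] by simp
  \<comment> \<open>All entropies are written as sums against p(awb), by summing out the letters
    that do not occur in the logarithm, so that one pointwise inequality can be added up. H_(n+1)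
    appears twice, once through the words aw and once through the words wb.\<close>
  have H2: "block_entropy M (Suc (Suc n)) = - ?S (\<lambda>a w b. p (a # w @ [b]) * ln (p (a # w @ [b])))"
    by (simp add: block_entropy_def sum_words_Cons[of _ "Suc n"] sum_words_snoc[of _ n] p_def)
      (intro sum.cong refl sum.swap)
  have H0: "block_entropy M n = - ?S (\<lambda>a w b. p (a # w @ [b]) * ln (p w))"
    by (simp add: block_entropy_def sum1 sum2' p_def[symmetric] flip: sum_distrib_right)
  have Ha: "block_entropy M (Suc n) = - ?S (\<lambda>a w b. p (a # w @ [b]) * ln (p (a # w)))"
    by (simp add: block_entropy_def sum_words_Cons sum2' p_def[symmetric] flip: sum_distrib_right)
  have Hb: "block_entropy M (Suc n) = - ?S (\<lambda>a w b. p (a # w @ [b]) * ln (p (w @ [b])))"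
  proof -
    have "?S (\<lambda>a w b. p (a # w @ [b]) * ln (p (w @ [b]))) =
      (\<Sum>w | length w = n. \<Sum>b\<in>UNIV. \<Sum>a\<in>UNIV. p (a # w @ [b]) * ln (p (w @ [b])))"
      by (intro sum.cong refl sum.swap)
    then show ?thesis
      by (simp add: block_entropy_def sum_words_snoc sum1 p_def[symmetric] flip: sum_distrib_right)
  qed
  have pointwise: "p (a # w @ [b]) - p (a # w) * p (w @ [b]) / p w \<le>
    p (a # w @ [b]) * ln (p (a # w @ [b])) + p (a # w @ [b]) * ln (p w)
    - p (a # w @ [b]) * ln (p (a # w)) - p (a # w @ [b]) * ln (p (w @ [b]))" for a w b
  proof (cases "p (a # w @ [b]) = 0")
    case True
    then show ?thesis using pos by simp
  next
    case False
    then have P: "p (a # w @ [b]) > 0" using pos[of "a # w @ [b]"] by simp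
    then have P1: "p (a # w) > 0" "p (w @ [b]) > 0"
      using le2[of "a # w" b] le1[of a "w @ [b]"] by auto
    then have P2: "p w > 0"
      using le1[of a w] by simp
    \<comment> \<open>This is the reciprocal of the t in the remark above the lemma, so the bound
      takes the form ln t \<le> t - 1.\<close>
    let ?t = "p (a # w) * p (w @ [b]) / (p (a # w @ [b]) * p w)"
    have "ln ?t \<le> ?t - 1"
      using P P1 P2 by (intro ln_le_minus_one) simp
    moreover have "ln ?t = ln (p (a # w)) + ln (p (w @ [b])) - (ln (p (a # w @ [b])) + ln (p w))"
      using P P1 P2 by (simp add: ln_mult ln_div)
    ultimately have "p (a # w @ [b]) * (ln (p (a # w)) + ln (p (w @ [b])) - (ln (p (a # w @ [b])) + ln (p w)))
        \<le> p (a # w @ [b]) * (?t - 1)"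
      using P by (intro mult_left_mono) auto
    also have "\<dots> = p (a # w) * p (w @ [b]) / p w - p (a # w @ [b])"
      using P P2 by (simp add: field_simps)
    finally show ?thesis by (simp add: algebra_simps)
  qed
  \<comment> \<open>For p(w) = 0 both sides are 0, since division by zero yields 0.\<close>
  have "(\<Sum>a\<in>UNIV. \<Sum>b\<in>UNIV. p (a # w) * p (w @ [b]) / p w) = p w" for w
  proof -
    have "(\<Sum>a\<in>UNIV. \<Sum>b\<in>UNIV. p (a # w) * p (w @ [b]) / p w) =
      (\<Sum>a\<in>UNIV. p (a # w)) * (\<Sum>b\<in>UNIV. p (w @ [b])) / p w"
      by (simp only: sum_product sum_divide_distrib)
    then show ?thesis by (simp add: sum1 sum2)
  qed
  then have "?S (\<lambda>a w b. p (a # w) * p (w @ [b]) / p w) = (\<Sum>w | length w = n. p w)"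
    by simp
  also have "\<dots> = ?S (\<lambda>a w b. p (a # w @ [b]))"
    by (simp add: sum1 sum2')
  finally have "0 = ?S (\<lambda>a w b. p (a # w @ [b]) - p (a # w) * p (w @ [b]) / p w)"
    by (simp add: sum_subtractf)
  also have "\<dots> \<le> ?S (\<lambda>a w b. p (a # w @ [b]) * ln (p (a # w @ [b])) + p (a # w @ [b]) * ln (p w)
    - p (a # w @ [b]) * ln (p (a # w)) - p (a # w @ [b]) * ln (p (w @ [b])))"
    by (intro sum_mono pointwise)
  also have "\<dots> = 2 * block_entropy M (Suc n) - block_entropy M n - block_entropy M (Suc (Suc n))"
  proof -
    have "2 * block_entropy M (Suc n) = block_entropy M (Suc n) + block_entropy M (Suc n)"
      by simp
    also have "\<dots> = - ?S (\<lambda>a w b. p (a # w @ [b]) * ln (p (a # w))) - ?S (\<lambda>a w b. p (a # w @ [b]) * ln (p (w @ [b])))"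
      using Ha Hb by linarith
    finally show ?thesis
      unfolding H2 H0 by (simp add: sum_subtractf sum.distrib)
  qed
  finally show ?thesis by simp
qed

text \<open>Concavity makes the increments nonincreasing. As H_0 = 0, H_n is a sum of n increments,
  none of them smaller than the next one.\<close>

lemma block_entropy_increment_le: "n * (block_entropy M (Suc n) - block_entropy M n) \<le> block_entropy M n"
proof (induction n)
  case (Suc n)
  have "block_entropy M (Suc (Suc n)) - block_entropy M (Suc n) \<le> block_entropy M (Suc n) - block_entropy M n"
    using block_entropy_concave[of n] by simp
  then have "Suc n * (block_entropy M (Suc (Suc n)) - block_entropy M (Suc n)) \<le>
      Suc n * (block_entropy M (Suc n) - block_entropy M n)"
    by (intro mult_left_mono) auto
  also have "\<dots> \<le> block_entropy M (Suc n)"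
    using Suc by (simp add: algebra_simps)
  finally show ?case .
qed simp

text \<open>From n = 1 on the ratio is nonincreasing and nonnegative. The value at n = 0 is 0 by
  division by zero and would break monotonicity, hence the shift of the index.\<close>

lemma convergent_block_entropy: "convergent (\<lambda>n. block_entropy M n / n)"
proof -
  have "decseq (\<lambda>n. block_entropy M (Suc n) / Suc n)"
  proof (rule decseq_SucI)
    fix n
    show "block_entropy M (Suc (Suc n)) / Suc (Suc n) \<le> block_entropy M (Suc n) / Suc n"
      using block_entropy_increment_le[of "Suc n"] by (simp add: field_simps)
  qed
  then obtain L where "(\<lambda>n. block_entropy M (Suc n) / Suc n) \<longlonglongrightarrow> L"
    using block_entropy_nonneg by (elim decseq_convergent[where B=0]) auto
  then have "(\<lambda>n. block_entropy M n / n) \<longlonglongrightarrow> L"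
    by (rule LIMSEQ_imp_Suc)
  then show ?thesis by (rule convergentI)
qed

text \<open>The entropy is defined through \<open>lim\<close>, which carries no information unless the limit exists.\<close>

lemma block_entropy_limit_0:
  assumes "ks_entropy M left_shift = 0"
  shows "(\<lambda>n. block_entropy M n / n) \<longlonglongrightarrow> 0"
proof -
  let ?P = "range (\<lambda>b. {x :: nat \<Rightarrow> 'b. x 0 = b})"
  have "{x :: nat \<Rightarrow> 'b. x 0 = b} = cyl [b]" for b
    by auto
  then have "?P \<in> finite_partitions M"
    using cyl_events by (auto simp: finite_partitions_def partition_on_def disjoint_def space_M
        intro: exI[of _ "\<lambda>_. b" for b])
  \<comment> \<open>Vanishing of the supremum bounds the limit for every partition, in particular
    the one by the first letter.\<close>
  then have "ereal (lim (\<lambda>n. partition_entropy M (iterated_join M left_shift ?P n) / real n)) \<le> ks_entropy M left_shift"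
    unfolding ks_entropy_def by (rule SUP_upper)
  then have "lim (\<lambda>n. block_entropy M n / n) \<le> 0"
    by (simp add: partition_entropy_coordinates space_M assms)
  moreover have lim: "(\<lambda>n. block_entropy M n / n) \<longlonglongrightarrow> lim (\<lambda>n. block_entropy M n / n)"
    using convergent_block_entropy by (simp add: convergent_LIMSEQ_iff)
  moreover have "0 \<le> lim (\<lambda>n. block_entropy M n / n)"
    using lim block_entropy_nonneg by (intro LIMSEQ_le_const) auto
  ultimately show ?thesis by simp
qed

lemma integral_word:
  "(\<integral>x. (f (word n x) :: real) \<partial>M) = (\<Sum>w | length w = n. prob (cyl w) * f w)"
proof -
  have "(\<integral>x. f (word n x) \<partial>M) = (\<integral>x. (\<Sum>w | length w = n. indicator (cyl w) x * f w) \<partial>M)"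
  proof (rule arg_cong[where f="integral\<^sup>L M"], rule ext)
    fix x
    have "(\<Sum>w | length w = n. indicator (cyl w) x * f w) = (\<Sum>w\<in>{word n x}. indicator (cyl w) x * f w)"
      by (intro sum.mono_neutral_right) (auto simp: cyl_def)
    then show "f (word n x) = (\<Sum>w | length w = n. indicator (cyl w) x * f w)"
      by (simp add: in_cyl_word)
  qed
  also have "\<dots> = (\<Sum>w | length w = n. \<integral>x. indicator (cyl w) x * f w \<partial>M)"
    by (intro Bochner_Integration.integral_sum integrable_mult_left integrable_real_indicator cyl_events)
      (simp add: less_top[symmetric])
  finally show ?thesis
    by (simp add: cyl_events space_M)
qed

lemma measurable_word_M: "(\<lambda>x. (f (word n x) :: real)) \<in> borel_measurable M"
  by (simp add: measurable_cong_sets[OF sets_M refl])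

lemma integrable_word: "integrable M (\<lambda>x. (f (word n x) :: real))"
proof (rule integrable_const_bound[where B="Max ((\<lambda>w. \<bar>f w\<bar>) ` {w. length w = n})"])
  show "AE x in M. norm (f (word n x)) \<le> Max ((\<lambda>w. \<bar>f w\<bar>) ` {w. length w = n})"
    by (intro AE_I2 Max_ge) auto
qed (rule measurable_word_M)

lemma integral_left_shift:
  assumes "f \<in> borel_measurable M"
  shows "(\<integral>x. (f (left_shift x) :: real) \<partial>M) = (\<integral>x. f x \<partial>M)"
  using invariant integral_distr[of left_shift M M f] assms by (simp add: invariant_measure_def)

lemma block_entropy_eq_integral: "block_entropy M n = (\<integral>x. - ln (prob (cyl (word n x))) \<partial>M)"
  using integral_word[where f="\<lambda>w. - ln (prob (cyl w))" and n=n] by (simp add: block_entropy_def sum_negf)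

text \<open>There are finitely many words of each length, so those of probability zero carry no
  mass. This confines the default value ln 0 = 0 to a null set.\<close>

lemma AE_prob_word_pos: "AE x in M. \<forall>n. 0 < prob (cyl (word n x))"
  unfolding AE_all_countable
proof
  fix n
  have "AE x in M. \<forall>w\<in>{w. length w = n}. prob (cyl w) = 0 \<longrightarrow> x \<notin> cyl w"
  proof (rule AE_finite_allI[OF finite_words])
    fix w :: "'b list"
    show "AE x in M. prob (cyl w) = 0 \<longrightarrow> x \<notin> cyl w"
      using AE_I'[of "cyl w" M "\<lambda>x. x \<notin> cyl w"] cyl_events
      by (cases "prob (cyl w) = 0") (auto simp: emeasure_eq_measure null_sets_def)
  qed
  then show "AE x in M. 0 < prob (cyl (word n x))"
  proof eventually_elim
    case (elim x)
    then have "prob (cyl (word n x)) \<noteq> 0"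
      using in_cyl_word[of x n x] by auto
    then show ?case by (simp add: zero_less_measure_iff)
  qed
qed

end

subsection \<open>Recovering \<open>A\<^sub>0\<close> from \<open>\<sigma>(a)\<close> at zero entropy\<close>

text \<open>Apply ln t \<le> t - 1 to t = sqrt (P a / q a). The total mass of P is only bounded by
  one, because the conditional frequencies after a null word all vanish.\<close>

lemma hellinger_le_relative_entropy:
  fixes q P :: "'a::finite \<Rightarrow> real"
  assumes q: "\<And>a. 0 \<le> q a" "(\<Sum>a\<in>UNIV. q a) = 1"
    and P: "\<And>a. 0 \<le> P a" "(\<Sum>a\<in>UNIV. P a) \<le> 1"
    and pos: "\<And>a. 0 < q a \<Longrightarrow> 0 < P a"
  shows "(\<Sum>a\<in>UNIV. (sqrt (q a) - sqrt (P a))\<^sup>2) \<le> (\<Sum>a\<in>UNIV. q a * (ln (q a) - ln (P a)))"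
proof -
  have "2 * q a - 2 * (sqrt (q a) * sqrt (P a)) \<le> q a * (ln (q a) - ln (P a))" for a
  proof (cases "q a = 0")
    case False
    then have qa: "q a > 0" "P a > 0"
      using q(1)[of a] pos[of a] by auto
    define t where "t = sqrt (P a) / sqrt (q a)"
    have "ln t \<le> t - 1"
      using qa unfolding t_def by (intro ln_le_minus_one) simp
    moreover have "ln (P a) - ln (q a) = 2 * ln t"
      using qa by (simp add: t_def ln_div ln_sqrt)
    ultimately have "ln (P a) - ln (q a) \<le> 2 * (t - 1)"
      by simp
    then have "q a * (ln (P a) - ln (q a)) \<le> q a * (2 * (t - 1))"
      using qa by (intro mult_left_mono) auto
    also have "\<dots> = 2 * (sqrt (q a) * sqrt (P a)) - 2 * q a"
      using qa real_sqrt_mult_self[of "q a"] by (simp add: t_def field_simps)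
    finally show ?thesis by (simp add: algebra_simps)
  qed simp
  then have "(\<Sum>a\<in>UNIV. 2 * q a - 2 * (sqrt (q a) * sqrt (P a))) \<le> (\<Sum>a\<in>UNIV. q a * (ln (q a) - ln (P a)))"
    by (intro sum_mono)
  moreover have "(\<Sum>a\<in>UNIV. (sqrt (q a) - sqrt (P a))\<^sup>2) =
      (\<Sum>a\<in>UNIV. q a + P a - 2 * (sqrt (q a) * sqrt (P a)))"
    using q(1) P(1) by (intro sum.cong refl) (simp add: power2_diff)
  moreover have "\<dots> \<le> (\<Sum>a\<in>UNIV. 2 * q a - 2 * (sqrt (q a) * sqrt (P a)))"
    using q(2) P(2) by (simp add: sum_subtractf sum.distrib flip: sum_distrib_left)
  ultimately show ?thesis by linarith
qed

section \<open>Resampling the first letter\<close>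

locale fibred_shift = N: shift_measure \<nu> for \<nu> :: "(nat \<Rightarrow> 'a::finite set) measure" +
  assumes nonempty: "AE A in \<nu>. \<forall>i. A i \<noteq> {}"
begin

abbreviation \<mu> :: "(nat \<Rightarrow> 'a) measure" where "\<mu> \<equiv> \<nu> \<bind> fibre_measure"

abbreviation J :: "((nat \<Rightarrow> 'a set) \<times> (nat \<Rightarrow> 'a)) measure" where "J \<equiv> joint_measure \<nu>"

abbreviation F2 :: "((nat \<Rightarrow> 'a set) \<times> (nat \<Rightarrow> 'a)) measure" where
  "F2 \<equiv> full_shift \<Otimes>\<^sub>M full_shift"

lemma sets_\<mu>: "sets \<mu> = sets full_shift"
  by (rule sets_bind_fibre[OF N.sets_M N.prob_space_axioms])

sublocale M: shift_measure \<mu>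
proof (intro shift_measure.intro shift_measure_axioms.intro)
  show "prob_space \<mu>"
    by (rule prob_space_bind_fibre[OF N.sets_M N.prob_space_axioms])
  show "invariant_measure \<mu> left_shift"
    by (rule invariant_measure_bind_fibre[OF N.sets_M N.prob_space_axioms measurable_left_shift N.invariant])
      (simp add: distr_fibre_measure_left_shift)
qed (rule sets_\<mu>)

sublocale J: prob_space J
  by (rule prob_space_joint_measure[OF N.sets_M N.prob_space_axioms])

lemma sets_J: "sets J = sets F2"
  by (rule sets_joint_measure[OF N.sets_M N.prob_space_axioms])

lemma measurable_J_iff: "f \<in> measurable J L \<longleftrightarrow> f \<in> measurable F2 L"
  by (simp add: measurable_cong_sets[OF sets_J refl])

lemma distr_J_fst: "distr J \<nu> fst = \<nu>"
  using distr_joint_fst[OF N.sets_M N.prob_space_axioms] distr_cong[of J J \<nu> full_shift fst fst]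
  by (simp add: N.sets_M)

lemma distr_J_snd: "distr J \<mu> snd = \<mu>"
  using distr_joint_snd[OF N.sets_M N.prob_space_axioms] distr_cong[of J J \<mu> full_shift snd snd]
  by (simp add: sets_\<mu>)

lemma measurable_fst_J: "fst \<in> measurable J \<nu>" and measurable_snd_J: "snd \<in> measurable J \<mu>"
  by (simp_all add: measurable_J_iff measurable_cong_sets[OF refl N.sets_M] measurable_cong_sets[OF refl sets_\<mu>])

lemma AE_J_fst: "(AE A in \<nu>. P A) \<Longrightarrow> (AE q in J. P (fst q))"
  using AE_distrD[OF measurable_fst_J, of P] by (simp only: distr_J_fst)

lemma AE_J_snd: "(AE x in \<mu>. P x) \<Longrightarrow> (AE q in J. P (snd q))"
  using AE_distrD[OF measurable_snd_J, of P] by (simp only: distr_J_snd)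

lemma integral_J_snd: "f \<in> borel_measurable full_shift \<Longrightarrow> (\<integral>q. f (snd q) \<partial>J) = (\<integral>x. (f x :: real) \<partial>\<mu>)"
  using integral_distr[OF measurable_snd_J, of f]
  by (simp add: distr_J_snd measurable_cong_sets[OF sets_\<mu> refl])

lemma integral_J_fst: "f \<in> borel_measurable full_shift \<Longrightarrow> (\<integral>q. f (fst q) \<partial>J) = (\<integral>x. (f x :: real) \<partial>\<nu>)"
  using integral_distr[OF measurable_fst_J, of f]
  by (simp add: distr_J_fst measurable_cong_sets[OF N.sets_M refl])

lemma AE_J_mem: "AE q in J. \<forall>i. snd q i \<in> fst q i"
  by (rule AE_joint_mem[OF N.sets_M N.prob_space_axioms nonempty])

lemma measurable_replace: "(\<lambda>q. (fst q, case_nat a (left_shift (snd q)))) \<in> measurable F2 F2"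
  by measurable

abbreviation weight :: "(nat \<Rightarrow> 'a set) \<Rightarrow> 'a \<Rightarrow> real" where
  "weight A a \<equiv> pmf (pmf_of_set (A 0)) a"

lemma measurable_weight: "(\<lambda>q. weight (fst q) a) \<in> borel_measurable F2"
  by (rule measurable_compose[OF measurable_compose[OF measurable_fst measurable_shift_coord]]) simp

lemma sum_weight: "(\<Sum>a\<in>UNIV. weight A a) = 1"
  by (rule sum_pmf_eq_1) auto

text \<open>Given \<open>A\<close>, the coordinate \<open>x\<^sub>0\<close> is independent of \<open>\<sigma>(x)\<close>, so it may be resampled.\<close>

lemma nn_integral_resample:
  assumes f: "f \<in> borel_measurable F2"
  shows "(\<integral>\<^sup>+q. f q \<partial>J) =
    (\<integral>\<^sup>+q. (\<Sum>a\<in>UNIV. ennreal (weight (fst q) a) * f (fst q, case_nat a (left_shift (snd q)))) \<partial>J)"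
proof -
  have m: "(\<lambda>q. \<Sum>a\<in>UNIV. ennreal (weight (fst q) a) * f (fst q, case_nat a (left_shift (snd q)))) \<in> borel_measurable F2"
    by (intro borel_measurable_sum borel_measurable_times_ennreal measurable_compose[OF measurable_replace f]
        measurable_compose[OF measurable_weight measurable_ennreal])
  have "(\<integral>\<^sup>+x. f (A, x) \<partial>fibre_measure A) =
    (\<integral>\<^sup>+x. (\<Sum>a\<in>UNIV. ennreal (weight A a) * f (A, case_nat a (left_shift x))) \<partial>fibre_measure A)" for A
  proof -
    have fA: "(\<lambda>x. f (A, x)) \<in> borel_measurable full_shift"
      by (rule measurable_compose[OF _ f]) simp
    then have fa: "(\<lambda>y. f (A, case_nat a y)) \<in> borel_measurable full_shift" for a
      by (rule measurable_compose[OF measurable_case_nat])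
    have "(\<integral>\<^sup>+x. f (A, x) \<partial>fibre_measure A) =
      (\<Sum>a\<in>UNIV. ennreal (weight A a) * (\<integral>\<^sup>+y. f (A, case_nat a y) \<partial>fibre_measure (left_shift A)))"
      by (rule nn_integral_fibre_measure_split[OF fA])
    also have "\<dots> = (\<integral>\<^sup>+y. (\<Sum>a\<in>UNIV. ennreal (weight A a) * f (A, case_nat a y)) \<partial>fibre_measure (left_shift A))"
    proof -
      have [measurable]: "(\<lambda>y. f (A, case_nat a y)) \<in> borel_measurable (fibre_measure (left_shift A))" for a
        using fa by (simp add: measurable_cong_sets[OF sets_fibre_measure refl])
      show ?thesis
        by (subst nn_integral_sum, measurable, intro sum.cong refl nn_integral_cmult[symmetric]) measurable
    qed
    also have "\<dots> = (\<integral>\<^sup>+y. (\<Sum>a\<in>UNIV. ennreal (weight A a) * f (A, case_nat a y))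
        \<partial>distr (fibre_measure A) full_shift left_shift)"
      by (simp add: distr_fibre_measure_left_shift)
    also have "\<dots> = (\<integral>\<^sup>+x. (\<Sum>a\<in>UNIV. ennreal (weight A a) * f (A, case_nat a (left_shift x))) \<partial>fibre_measure A)"
      using fa by (intro nn_integral_distr) auto
    finally show ?thesis .
  qed
  then show ?thesis
    by (simp add: nn_integral_joint_measure[OF N.sets_M N.prob_space_axioms] f m)
qed

text \<open>Adding B reduces the bounded real case to the nonnegative one; resampling respects the
  constant because the weights sum to one.\<close>

lemma integral_resample:
  fixes f :: "(nat \<Rightarrow> 'a set) \<times> (nat \<Rightarrow> 'a) \<Rightarrow> real"
  assumes f: "f \<in> borel_measurable F2" and B: "\<And>q. \<bar>f q\<bar> \<le> B"
  shows "(\<integral>q. f q \<partial>J) =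
    (\<integral>q. (\<Sum>a\<in>UNIV. weight (fst q) a * f (fst q, case_nat a (left_shift (snd q)))) \<partial>J)"
proof -
  let ?R = "\<lambda>f q. \<Sum>a\<in>UNIV. weight (fst q) a * f (fst q, case_nat a (left_shift (snd q)))"
  have Rm: "?R f \<in> borel_measurable F2"
    by (intro borel_measurable_sum borel_measurable_times measurable_compose[OF measurable_replace f] measurable_weight)
  have Rsum: "?R (\<lambda>q. f q + B) q = ?R f q + B" for q
    by (simp add: distrib_left sum.distrib sum_weight flip: sum_distrib_right)
  have RB: "\<bar>?R f q\<bar> \<le> B" for q
  proof -
    have "\<bar>?R f q\<bar> \<le> (\<Sum>a\<in>UNIV. \<bar>weight (fst q) a * f (fst q, case_nat a (left_shift (snd q)))\<bar>)"
      by (rule sum_abs)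
    also have "\<dots> \<le> (\<Sum>a\<in>UNIV. weight (fst q) a * B)"
      by (intro sum_mono) (simp add: abs_mult mult_left_mono B)
    finally show ?thesis
      by (simp add: sum_weight flip: sum_distrib_right)
  qed
  have int: "integrable J f" "integrable J (?R f)"
    by (rule J.integrable_const_bound[where B=B], use f B Rm RB in \<open>auto simp: measurable_J_iff\<close>)+
  have nonneg: "0 \<le> f q + B" "0 \<le> ?R f q + B" for q
    using B[of q] RB[of q] by linarith+
  have "ennreal (\<integral>q. f q + B \<partial>J) = (\<integral>\<^sup>+q. ennreal (f q + B) \<partial>J)"
    using int nonneg by (intro nn_integral_eq_integral[symmetric]) auto
  also have "\<dots> = (\<integral>\<^sup>+q. (\<Sum>a\<in>UNIV. ennreal (weight (fst q) a) *
      ennreal (f (fst q, case_nat a (left_shift (snd q))) + B)) \<partial>J)"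
    by (rule nn_integral_resample[OF measurable_compose[OF borel_measurable_add[OF f borel_measurable_const] measurable_ennreal]])
  also have "\<dots> = (\<integral>\<^sup>+q. ennreal (?R f q + B) \<partial>J)"
    unfolding Rsum[symmetric] using nonneg(1)
    by (intro nn_integral_cong) (simp add: ennreal_mult'' flip: sum_ennreal)
  also have "\<dots> = ennreal (\<integral>q. ?R f q + B \<partial>J)"
    using int nonneg by (intro nn_integral_eq_integral) auto
  finally have "(\<integral>q. f q + B \<partial>J) = (\<integral>q. ?R f q + B \<partial>J)"
    using nonneg by (subst (asm) ennreal_inj) (auto intro!: integral_nonneg_AE)
  then show ?thesis
    using int by simp
qed

text \<open>The indicator of the exceptional set has integral zero also after resampling, so almost
  surely every replacement of positive weight avoids that set. It transfers what is known of x to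
  all points x(0 := a) with a in A_0 at once.\<close>

lemma AE_resample:
  assumes P: "{q. P q} \<in> sets F2" and ae: "AE q in J. P q"
  shows "AE q in J. \<forall>a. 0 < weight (fst q) a \<longrightarrow> P (fst q, case_nat a (left_shift (snd q)))"
proof -
  have N: "{q. \<not> P q} \<in> sets F2"
    using sets.Diff[OF sets.top P] by (simp add: space_pair_measure Collect_neg_eq Compl_eq_Diff_UNIV)
  let ?f = "indicator {q. \<not> P q} :: _ \<Rightarrow> ennreal"
  have f: "?f \<in> borel_measurable F2"
    using N by simp
  have m: "(\<lambda>q. \<Sum>a\<in>UNIV. ennreal (weight (fst q) a) * ?f (fst q, case_nat a (left_shift (snd q)))) \<in> borel_measurable J"
    unfolding measurable_J_iff
    by (intro borel_measurable_sum borel_measurable_times_ennreal measurable_compose[OF measurable_replace f]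
        measurable_compose[OF measurable_weight measurable_ennreal])
  have "(\<integral>\<^sup>+q. ?f q \<partial>J) = (\<integral>\<^sup>+q. 0 \<partial>J)"
    using ae by (intro nn_integral_cong_AE) (auto elim!: eventually_mono)
  then have "AE q in J. (\<Sum>a\<in>UNIV. ennreal (weight (fst q) a) * ?f (fst q, case_nat a (left_shift (snd q)))) = 0"
    using nn_integral_resample[OF f] nn_integral_0_iff_AE[OF m] by simp
  then show ?thesis
  proof eventually_elim
    case (elim q)
    then have 0: "ennreal (weight (fst q) a) * ?f (fst q, case_nat a (left_shift (snd q))) = 0" for a
      by (subst (asm) sum_eq_0_iff) (simp_all only: finite UNIV_I ball_UNIV)
    show ?case
    proof (intro allI impI, rule ccontr)
      fix a assume "0 < weight (fst q) a" "\<not> P (fst q, case_nat a (left_shift (snd q)))"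
      then show False
        using 0[of a] by simp
    qed
  qed
qed

lemma measurable_words: "(\<lambda>q. (g (word n (fst q)) (word m (snd q)) :: real)) \<in> borel_measurable F2"
  by (rule measurable_compose_countable[where g="\<lambda>q. word n (fst q)" and f="\<lambda>v q. g v (word m (snd q))"])
    (auto intro: measurable_compose[OF measurable_compose[OF measurable_snd measurable_word]]
      measurable_compose[OF measurable_fst measurable_word])

lemma bounded_words: "\<exists>B. \<forall>q :: (nat \<Rightarrow> 'a set) \<times> (nat \<Rightarrow> 'a). \<bar>g (word n (fst q)) (word m (snd q)) :: real\<bar> \<le> B"
proof -
  let ?X = "(\<lambda>(v, w). \<bar>g v w\<bar>) ` ({v. length v = n} \<times> {w. length w = m})"
  have "\<bar>g (word n (fst q)) (word m (snd q))\<bar> \<le> Max ?X" for q :: "(nat \<Rightarrow> 'a set) \<times> (nat \<Rightarrow> 'a)"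
    by (intro Max_ge finite_imageI finite_cartesian_product finite_words)
      (auto intro!: image_eqI[of _ _ "(word n (fst q), word m (snd q))"])
  then show ?thesis by blast
qed

lemma integrable_words: "integrable J (\<lambda>q. (g (word n (fst q)) (word m (snd q)) :: real))"
proof -
  obtain B where "\<And>q. \<bar>g (word n (fst q)) (word m (snd q))\<bar> \<le> B"
    using bounded_words by blast
  then show ?thesis
    using measurable_words by (intro J.integrable_const_bound[where B=B]) (auto simp: measurable_J_iff)
qed

end

section \<open>Comparing the uniform and the conditional law of the first letter\<close>

context fibred_shift
begin

abbreviation p :: "'a list \<Rightarrow> real" where "p w \<equiv> measure \<mu> (cyl w)"

text \<open>The probability of a under P_m, as a function of y = \<sigma>(x); it is 0 after a null
  word.\<close>

definition cond_freq :: "nat \<Rightarrow> 'a \<Rightarrow> (nat \<Rightarrow> 'a) \<Rightarrow> real" where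
  "cond_freq m a y = p (a # word m y) / p (word m y)"

text \<open>The squared Hellinger distance between q and P_m, without the customary factor
  1/2.\<close>

definition gap :: "nat \<Rightarrow> (nat \<Rightarrow> 'a set) \<times> (nat \<Rightarrow> 'a) \<Rightarrow> real" where
  "gap m q = (\<Sum>a\<in>UNIV. (sqrt (weight (fst q) a) - sqrt (cond_freq m a (left_shift (snd q))))\<^sup>2)"

text \<open>The entropy of x_0 conditioned on A.\<close>

definition mean_log_card :: real where
  "mean_log_card = (\<integral>A. ln (real (card (A 0))) \<partial>\<nu>)"

lemma gap_nonneg: "0 \<le> gap m q"
  by (simp add: gap_def sum_nonneg)

lemma integrable_gap: "integrable J (gap m)"
proof -
  \<comment> \<open>The gap reads one set and m + 1 letters, the first of which \<open>tl\<close>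
    discards; with finite alphabets such a function is bounded.\<close>
  let ?g = "\<lambda>v w. \<Sum>a\<in>UNIV. (sqrt (pmf (pmf_of_set (hd v)) a) - sqrt (p (a # tl w) / p (tl w)))\<^sup>2"
  have "gap m = (\<lambda>q. ?g (word 1 (fst q)) (word (Suc m) (snd q)))"
    by (simp add: fun_eq_iff gap_def cond_freq_def word_Suc)
  then show ?thesis
    using integrable_words[where g="?g" and n=1 and m="Suc m"] by (simp only:)
qed

lemma word_events: "{q. R (word n (snd q))} \<in> sets F2"
proof -
  have "{q. R (word n (snd q))} = (\<lambda>q. word n (snd q)) -` {w. R w} \<inter> space F2"
    by (auto simp: space_pair_measure)
  also have "\<dots> \<in> sets F2"
    by (rule measurable_sets[OF measurable_compose[OF measurable_snd measurable_word]]) simp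
  finally show ?thesis .
qed

lemma AE_J_nonempty: "AE q in J. \<forall>i. fst q i \<noteq> {}"
  using AE_J_mem by eventually_elim auto

text \<open>The right-hand side is the relative entropy of q with respect to P_m: as q is uniform on
  A_0, the sum of q ln q is - ln |A_0|.\<close>

lemma gap_le_weighted_log:
  assumes ne: "fst q 0 \<noteq> {}"
    and pos: "\<forall>a. 0 < weight (fst q) a \<longrightarrow> 0 < p (a # word m (left_shift (snd q)))"
  shows "gap m q \<le> (\<Sum>a\<in>UNIV. weight (fst q) a *
      (ln (p (word m (left_shift (snd q)))) - ln (p (a # word m (left_shift (snd q))))))
    - ln (real (card (fst q 0)))"
proof -
  define v where "v = word m (left_shift (snd q))"
  have le: "p (a # v) \<le> p v" for a
    using M.sum_prob_cyl_Cons[of v] member_le_sum[of a UNIV "\<lambda>a. p (a # v)"] by simp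
  have "gap m q = (\<Sum>a\<in>UNIV. (sqrt (weight (fst q) a) - sqrt (p (a # v) / p v))\<^sup>2)"
    by (simp add: gap_def cond_freq_def v_def)
  also have "\<dots> \<le> (\<Sum>a\<in>UNIV. weight (fst q) a * (ln (weight (fst q) a) - ln (p (a # v) / p v)))"
  proof (rule hellinger_le_relative_entropy)
    show "(\<Sum>a\<in>UNIV. p (a # v) / p v) \<le> 1"
      by (simp add: M.sum_prob_cyl_Cons flip: sum_divide_distrib)
    show "0 < p (a # v) / p v" if "0 < weight (fst q) a" for a
      using pos that le[of a] by (auto simp: v_def[symmetric] intro!: divide_pos_pos)
  qed (simp_all add: sum_weight)
  also have "\<dots> = (\<Sum>a\<in>UNIV. weight (fst q) a * (ln (p v) - ln (p (a # v))) -
      weight (fst q) a * ln (real (card (fst q 0))))"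
  proof (intro sum.cong refl)
    fix a
    show "weight (fst q) a * (ln (weight (fst q) a) - ln (p (a # v) / p v)) =
      weight (fst q) a * (ln (p v) - ln (p (a # v))) - weight (fst q) a * ln (real (card (fst q 0)))"
    proof (cases "weight (fst q) a = 0")
      case False
      then have w: "0 < weight (fst q) a"
        by (simp add: pmf_pos)
      then have "a \<in> fst q 0"
        using ne w by (cases "a \<in> fst q 0") (auto simp: pmf_of_set)
      then have "ln (weight (fst q) a) = - ln (real (card (fst q 0)))"
        using ne by (simp add: pmf_of_set ln_div card_gt_0_iff)
      moreover have "0 < p (a # v)" "0 < p v"
        using pos w le[of a] by (auto simp: v_def[symmetric])
      ultimately show ?thesis
        by (simp add: ln_div algebra_simps)
    qed simp
  qed
  also have "\<dots> = (\<Sum>a\<in>UNIV. weight (fst q) a * (ln (p v) - ln (p (a # v)))) - ln (real (card (fst q 0)))"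
    by (simp add: sum_subtractf sum_weight flip: sum_distrib_right)
  finally show ?thesis by (simp add: v_def)
qed

lemma integral_log_card:
  "(\<integral>q. ln (real (card (fst q i))) \<partial>J) = mean_log_card"
proof -
  have m: "(\<lambda>A :: nat \<Rightarrow> 'a set. ln (real (card (A i)))) \<in> borel_measurable full_shift" for i
    by (rule measurable_compose[OF measurable_shift_coord]) simp
  have "(\<integral>A. ln (real (card (A i))) \<partial>\<nu>) = mean_log_card"
  proof (induction i)
    case (Suc i)
    then show ?case
      using N.integral_left_shift[of "\<lambda>A. ln (real (card (A i)))"] m
      by (simp add: measurable_cong_sets[OF N.sets_M refl] left_shift_def)
  qed (simp add: mean_log_card_def)
  then show ?thesis
    by (simp add: integral_J_fst[OF m])
qed

lemma integrable_log_card: "integrable J (\<lambda>q. ln (real (card (fst q i))))"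
  using integrable_words[where g="\<lambda>v w. ln (real (card (v ! i)))" and n="Suc i" and m=0]
  by (simp add: nth_word)

text \<open>The difference of the block entropies is the entropy of \<open>x\<^sub>0\<close> given \<open>x\<^sub>1, \<dots>, x\<^sub>m\<close>;
  after resampling \<open>x\<^sub>0\<close>, its excess over the entropy of \<open>x\<^sub>0\<close> given \<open>A\<close> is a relative entropy.\<close>

lemma integral_gap_le:
  "(\<integral>q. gap m q \<partial>J) \<le> block_entropy \<mu> (Suc m) - block_entropy \<mu> m - mean_log_card"
proof -
  \<comment> \<open>Minus the logarithm of the conditional probability of the first letter of w
    given the others; by shift invariance its mean is H_(m+1) - H_m.\<close>
  define f where "f w = ln (p (tl w)) - ln (p w)" for w
  have "(\<integral>q. f (word (Suc m) (snd q)) \<partial>J) = (\<integral>x. f (word (Suc m) x) \<partial>\<mu>)"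
    by (rule integral_J_snd, rule measurable_compose[OF measurable_word]) simp
  also have "\<dots> = (\<integral>x. (- ln (p (word (Suc m) x))) - (- ln (p (tl (word (Suc m) x)))) \<partial>\<mu>)"
    by (simp add: f_def)
  also have "\<dots> = (\<integral>x. - ln (p (word (Suc m) x)) \<partial>\<mu>) - (\<integral>x. - ln (p (tl (word (Suc m) x))) \<partial>\<mu>)"
    by (rule Bochner_Integration.integral_diff) (rule M.integrable_word)+
  also have "(\<integral>x. - ln (p (tl (word (Suc m) x))) \<partial>\<mu>) = (\<integral>x. - ln (p (word m (left_shift x))) \<partial>\<mu>)"
    by (simp add: word_Suc)
  also have "\<dots> = (\<integral>x. - ln (p (word m x)) \<partial>\<mu>)"
    by (rule M.integral_left_shift[OF M.measurable_word_M])
  finally have 1: "(\<integral>q. f (word (Suc m) (snd q)) \<partial>J) = block_entropy \<mu> (Suc m) - block_entropy \<mu> m"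
    by (simp add: M.block_entropy_eq_integral)
  obtain B where B: "\<bar>f (word (Suc m) (snd q))\<bar> \<le> B" for q :: "(nat \<Rightarrow> 'a set) \<times> (nat \<Rightarrow> 'a)"
    using bounded_words[of "\<lambda>v w. f w"] by blast
  define g where "g q = (\<Sum>a\<in>UNIV. weight (fst q) a *
      (ln (p (word m (left_shift (snd q)))) - ln (p (a # word m (left_shift (snd q))))))" for q
  have fm: "(\<lambda>q. f (word (Suc m) (snd q))) \<in> borel_measurable F2"
    by (rule measurable_words)
  have 2: "(\<integral>q. f (word (Suc m) (snd q)) \<partial>J) = (\<integral>q. g q \<partial>J)"
    using integral_resample[OF fm B] by (simp add: f_def g_def word_Suc)
  let ?g = "\<lambda>v w. \<Sum>a\<in>UNIV. pmf (pmf_of_set (hd v)) a * (ln (p (tl w)) - ln (p (a # tl w)))"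
  have "g = (\<lambda>q. ?g (word 1 (fst q)) (word (Suc m) (snd q)))"
    by (simp add: fun_eq_iff g_def word_Suc)
  then have g: "integrable J g"
    using integrable_words[where g="?g" and n=1 and m="Suc m"] by (simp only:)
  have "(\<integral>q. gap m q \<partial>J) \<le> (\<integral>q. g q - ln (real (card (fst q 0))) \<partial>J)"
  proof (rule integral_mono_AE)
    \<comment> \<open>Positivity is known for the word actually seen. Resampling gives it for every
      a in A_0 followed by the same x_1, ..., x_m, as the relative entropy bound requires.\<close>
    have "AE q in J. 0 < p (word (Suc m) (snd q))"
      by (rule AE_J_snd) (use M.AE_prob_word_pos in auto)
    from AE_resample[OF word_events this] AE_J_nonempty
    show "AE q in J. gap m q \<le> g q - ln (real (card (fst q 0)))"
    proof eventually_elim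
      case (elim q)
      then show ?case
        unfolding g_def by (intro gap_le_weighted_log) (auto simp: word_Suc)
    qed
  qed (use g integrable_log_card integrable_gap in auto)
  also have "\<dots> = (\<integral>q. g q \<partial>J) - mean_log_card"
    using g integrable_log_card by (simp add: integral_log_card)
  finally show ?thesis
    using 1 2 by simp
qed

text \<open>Keep in the mixture only those B that agree with A on the first n sets; each contributes
  the same fibre probability. This is the pointwise form of the fact that a has at most the entropy
  of (A, a).\<close>

lemma prob_cyl_ge:
  assumes "\<And>i. i < n \<Longrightarrow> x i \<in> A i"
  shows "measure \<nu> (cyl (word n A)) * (\<Prod>i<n. 1 / real (card (A i))) \<le> p (word n x)"
proof -
  have "ennreal (measure \<nu> (cyl (word n A)) * (\<Prod>i<n. 1 / real (card (A i)))) =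
    (\<integral>\<^sup>+B. ennreal (\<Prod>i<n. 1 / real (card (A i))) * indicator (cyl (word n A)) B \<partial>\<nu>)"
    by (subst nn_integral_cmult_indicator[OF N.cyl_events])
      (simp add: N.emeasure_eq_measure mult.commute prod_nonneg flip: ennreal_mult'')
  also have "\<dots> \<le> (\<integral>\<^sup>+B. emeasure (fibre_measure B) (cyl (word n x)) \<partial>\<nu>)"
  proof (intro nn_integral_mono)
    fix B
    have "emeasure (fibre_measure B) (cyl (word n x)) = ennreal (\<Prod>i<n. 1 / real (card (A i)))"
      if "B \<in> cyl (word n A)"
    proof -
      have B: "B i = A i" if "i < n" for i
        using \<open>B \<in> cyl (word n A)\<close> that by (simp add: in_cyl_word word_eq_iff)
      have "(\<Prod>i<n. ennreal (pmf (pmf_of_set (B i)) (word n x ! i))) = (\<Prod>i<n. ennreal (1 / real (card (A i))))"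
      proof (intro prod.cong refl)
        fix i assume "i \<in> {..<n}"
        then show "ennreal (pmf (pmf_of_set (B i)) (word n x ! i)) = ennreal (1 / real (card (A i)))"
          using assms[of i] by (subst pmf_of_set) (auto simp: B nth_word)
      qed
      then show ?thesis
        by (simp add: emeasure_fibre_measure_cyl prod_ennreal)
    qed
    then show "ennreal (\<Prod>i<n. 1 / real (card (A i))) * indicator (cyl (word n A)) B
        \<le> emeasure (fibre_measure B) (cyl (word n x))"
      by (auto split: split_indicator)
  qed
  also have "\<dots> = emeasure \<mu> (cyl (word n x))"
    by (rule emeasure_bind[OF N.not_empty measurable_fibre_\<nu>[OF N.sets_M N.prob_space_axioms] cyl_in_sets, symmetric])
  finally show ?thesis
    by (simp add: M.emeasure_eq_measure)
qed

text \<open>The entropy of \<open>a\<close> is at most that of \<open>(A, a)\<close>, which is the entropy of \<open>A\<close> plus the uniform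
  choices.\<close>

lemma block_entropy_\<mu>_le: "block_entropy \<mu> n \<le> block_entropy \<nu> n + n * mean_log_card"
proof -
  have "block_entropy \<mu> n = (\<integral>q. - ln (p (word n (snd q))) \<partial>J)"
    unfolding M.block_entropy_eq_integral
    by (rule integral_J_snd[symmetric], rule measurable_compose[OF measurable_word]) simp
  also have "\<dots> \<le> (\<integral>q. - ln (measure \<nu> (cyl (word n (fst q)))) + (\<Sum>i<n. ln (real (card (fst q i)))) \<partial>J)"
  proof (rule integral_mono_AE)
    show "integrable J (\<lambda>q. - ln (p (word n (snd q))))"
      by (rule integrable_words)
    show "integrable J (\<lambda>q. - ln (measure \<nu> (cyl (word n (fst q)))) + (\<Sum>i<n. ln (real (card (fst q i)))))"
      by (intro Bochner_Integration.integrable_add Bochner_Integration.integrable_sum integrable_log_card)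
        (rule integrable_words[where m=0 and g="\<lambda>v w. - ln (measure \<nu> (cyl v))"])
    show "AE q in J. - ln (p (word n (snd q))) \<le>
      - ln (measure \<nu> (cyl (word n (fst q)))) + (\<Sum>i<n. ln (real (card (fst q i))))"
      using AE_J_mem AE_J_fst[OF N.AE_prob_word_pos]
    proof eventually_elim
      case (elim q)
      have c: "0 < 1 / real (card (fst q i))" for i
        using elim(1) by (auto simp: card_gt_0_iff)
      have "ln (measure \<nu> (cyl (word n (fst q))) * (\<Prod>i<n. 1 / real (card (fst q i)))) \<le> ln (p (word n (snd q)))"
        using prob_cyl_ge[of n "snd q" "fst q"] elim c by (intro ln_mono mult_pos_pos prod_pos) auto
      moreover have "ln (measure \<nu> (cyl (word n (fst q))) * (\<Prod>i<n. 1 / real (card (fst q i)))) =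
          ln (measure \<nu> (cyl (word n (fst q)))) + ln (\<Prod>i<n. 1 / real (card (fst q i)))"
        using elim c by (intro ln_mult_pos prod_pos) auto
      moreover have "ln (\<Prod>i<n. 1 / real (card (fst q i))) = (\<Sum>i<n. ln (1 / real (card (fst q i))))"
        using elim(1) by (intro ln_prod) (auto simp: card_gt_0_iff)
      moreover have "\<dots> = - (\<Sum>i<n. ln (real (card (fst q i))))"
        unfolding sum_negf[symmetric]
      proof (intro sum.cong refl)
        fix i
        show "ln (1 / real (card (fst q i))) = - ln (real (card (fst q i)))"
          using elim(1) by (subst ln_div) (auto simp: card_gt_0_iff)
      qed
      ultimately show ?case by linarith
    qed
  qed
  also have "\<dots> = (\<integral>q. - ln (measure \<nu> (cyl (word n (fst q)))) \<partial>J) + n * mean_log_card"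
    using integrable_words[where m=0 and g="\<lambda>v w. - ln (measure \<nu> (cyl v))"]
    by (subst Bochner_Integration.integral_add)
      (auto intro!: Bochner_Integration.integrable_sum integrable_log_card
        simp: Bochner_Integration.integral_sum integrable_log_card integral_log_card)
  also have "(\<integral>q. - ln (measure \<nu> (cyl (word n (fst q)))) \<partial>J) = block_entropy \<nu> n"
    unfolding N.block_entropy_eq_integral
    by (rule integral_J_fst, rule measurable_compose[OF measurable_word]) simp
  finally show ?thesis .
qed

lemma sum_integral_gap_le: "(\<Sum>m<n. \<integral>q. gap m q \<partial>J) \<le> block_entropy \<nu> n"
proof -
  have "(\<Sum>m<n. \<integral>q. gap m q \<partial>J) \<le> (\<Sum>m<n. block_entropy \<mu> (Suc m) - block_entropy \<mu> m - mean_log_card)"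
    by (intro sum_mono integral_gap_le)
  also have "\<dots> = block_entropy \<mu> n - n * mean_log_card"
    by (simp add: sum_subtractf sum_lessThan_telescope[of "block_entropy \<mu>", unfolded sum_subtractf])
  finally show ?thesis
    using block_entropy_\<mu>_le[of n] by simp
qed

text \<open>That the mean gaps sum to o(n) yields arbitrarily small mean gaps, hence indices along
  which they tend to zero, and convergence in mean gives almost sure convergence along a
  subsequence. The indices need not increase.\<close>

lemma gap_tendsto_0:
  assumes "(\<lambda>n. block_entropy \<nu> n / n) \<longlonglongrightarrow> 0"
  shows "\<exists>\<rho>. AE q in J. (\<lambda>j. gap (\<rho> j) q) \<longlonglongrightarrow> 0"
proof -
  have "\<exists>m. (\<integral>q. gap m q \<partial>J) < e" if e: "0 < e" for e
  proof (rule ccontr)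
    assume "\<nexists>m. (\<integral>q. gap m q \<partial>J) < e"
    then have *: "e \<le> (\<integral>q. gap m q \<partial>J)" for m
      by (simp add: not_less)
    have "e \<le> block_entropy \<nu> n / n" if "n > 0" for n
    proof -
      have "n * e \<le> (\<Sum>m<n. \<integral>q. gap m q \<partial>J)"
        using sum_mono[of "{..<n}" "\<lambda>_. e" "\<lambda>m. \<integral>q. gap m q \<partial>J"] * by simp
      then show ?thesis
        using sum_integral_gap_le[of n] that by (simp add: field_simps)
    qed
    then have "e \<le> 0"
      by (intro LIMSEQ_le_const[OF assms]) (auto intro: exI[of _ 1])
    with e show False by simp
  qed
  then have "\<exists>m. (\<integral>q. gap m q \<partial>J) < inverse (real (Suc j))" for j
    by simp
  then obtain m where m: "(\<integral>q. gap (m j) q \<partial>J) < inverse (real (Suc j))" for j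
    by metis
  have "(\<lambda>j. \<integral>q. norm (gap (m j) q) \<partial>J) \<longlonglongrightarrow> 0"
  proof (rule tendsto_sandwich[OF _ _ tendsto_const LIMSEQ_inverse_real_of_nat])
    show "\<forall>\<^sub>F j in sequentially. (\<integral>q. norm (gap (m j) q) \<partial>J) \<le> inverse (real (Suc j))"
      using m by (intro always_eventually allI) (simp add: gap_nonneg less_imp_le)
  qed simp
  then obtain r where "AE q in J. (\<lambda>n. gap (m (r n)) q) \<longlonglongrightarrow> 0"
    using tendsto_L1_AE_subseq[of J "\<lambda>j. gap (m j)"] integrable_gap by auto
  then show ?thesis
    by (intro exI[of _ "\<lambda>j. m (r j)"])
qed

lemma recover_head:
  assumes "(\<lambda>n. block_entropy \<nu> n / n) \<longlonglongrightarrow> 0"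
  obtains F where "F \<in> measurable full_shift (count_space UNIV)"
    and "AE q in J. F (left_shift (snd q)) = fst q 0"
proof -
  obtain \<rho> where \<rho>: "AE q in J. (\<lambda>j. gap (\<rho> j) q) \<longlonglongrightarrow> 0"
    using gap_tendsto_0[OF assms] by blast
  \<comment> \<open>On A_0 the weights are at least 1/|\<Lambda>|, off A_0 they are 0; half of
    1/|\<Lambda>| separates the two cases in the limit.\<close>
  let ?c = "1 / (2 * real CARD('a))"
  \<comment> \<open>Asking for the threshold to be exceeded eventually makes F defined for all y,
    and measurable as a countable combination of events about words, even where the frequencies do
    not converge.\<close>
  define F where "F y = {a. \<exists>N. \<forall>j\<ge>N. ?c < cond_freq (\<rho> j) a y}" for y
  have a: "{y. a \<in> F y} \<in> sets full_shift" for a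
  proof -
    have c: "{y. ?c < cond_freq m a y} \<in> sets full_shift" for m
    proof -
      have "{y. ?c < cond_freq m a y} = word m -` {w. ?c < p (a # w) / p w} \<inter> space full_shift"
        by (auto simp: cond_freq_def)
      then show ?thesis
        using measurable_sets[OF measurable_word, of "{w. ?c < p (a # w) / p w}" m] by simp
    qed
    have "{y. a \<in> F y} = (\<Union>N. \<Inter>j\<in>{N..}. {y. ?c < cond_freq (\<rho> j) a y})"
      by (auto simp: F_def)
    also have "\<dots> \<in> sets full_shift"
      using sets.top[of "full_shift :: (nat \<Rightarrow> 'a) measure"]
      by (intro sets.countable_UN'' sets.countable_INT'' c) simp_all
    finally show ?thesis .
  qed
  have Fm: "F \<in> measurable full_shift (count_space UNIV)"
  proof (subst measurable_count_space_eq2_countable, safe)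
    fix B
    have "F -` {B} \<inter> space full_shift =
      (\<Inter>a\<in>UNIV. if a \<in> B then {y. a \<in> F y} else space full_shift - {y. a \<in> F y})"
      by (auto split: if_splits)
    also have "\<dots> \<in> sets full_shift"
      using a sets.Diff[OF sets.top a] by (intro sets.finite_INT) auto
    finally show "F -` {B} \<inter> space full_shift \<in> sets full_shift" .
  qed auto
  have "AE q in J. F (left_shift (snd q)) = fst q 0"
    using \<rho> AE_J_nonempty
  proof eventually_elim
    case (elim q)
    have lim: "(\<lambda>j. cond_freq (\<rho> j) a (left_shift (snd q))) \<longlonglongrightarrow> weight (fst q) a" for a
    proof -
      let ?P = "\<lambda>j. cond_freq (\<rho> j) a (left_shift (snd q))"
      have "(sqrt (weight (fst q) a) - sqrt (?P j))\<^sup>2 \<le> gap (\<rho> j) q" for j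
        unfolding gap_def
        by (rule member_le_sum[of a UNIV "\<lambda>a. (sqrt (weight (fst q) a) - sqrt (cond_freq (\<rho> j) a (left_shift (snd q))))\<^sup>2"]) auto
      then have "(\<lambda>j. (sqrt (weight (fst q) a) - sqrt (?P j))\<^sup>2) \<longlonglongrightarrow> 0"
        by (intro tendsto_sandwich[OF _ _ tendsto_const elim(1)]) auto
      then have "(\<lambda>j. sqrt (weight (fst q) a) - sqrt (?P j)) \<longlonglongrightarrow> 0"
        using tendsto_real_sqrt[of "\<lambda>j. (sqrt (weight (fst q) a) - sqrt (?P j))\<^sup>2" 0] by (simp add: tendsto_rabs_zero_iff)
      then have "(\<lambda>j. sqrt (weight (fst q) a) - (sqrt (weight (fst q) a) - sqrt (?P j))) \<longlonglongrightarrow> sqrt (weight (fst q) a) - 0"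
        by (intro tendsto_diff tendsto_const)
      then have "(\<lambda>j. (sqrt (?P j))\<^sup>2) \<longlonglongrightarrow> (sqrt (weight (fst q) a))\<^sup>2"
        by (intro tendsto_power) simp
      then show ?thesis
        by (simp add: cond_freq_def)
    qed
    have "a \<in> F (left_shift (snd q)) \<longleftrightarrow> a \<in> fst q 0" for a
    proof (cases "a \<in> fst q 0")
      case True
      then have "weight (fst q) a = 1 / real (card (fst q 0))" "0 < card (fst q 0)"
        using elim(2) by (auto simp: pmf_of_set card_gt_0_iff)
      moreover have "card (fst q 0) \<le> CARD('a)"
        by (rule card_mono) auto
      ultimately have "?c < weight (fst q) a"
        by (simp add: field_simps)
      then have "\<forall>\<^sub>F j in sequentially. ?c < cond_freq (\<rho> j) a (left_shift (snd q))"
        by (rule order_tendstoD(1)[OF lim])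
      then show ?thesis
        using True by (simp add: F_def eventually_sequentially)
    next
      case False
      then have "weight (fst q) a = 0"
        using elim(2) by (simp add: pmf_of_set)
      then have "\<forall>\<^sub>F j in sequentially. cond_freq (\<rho> j) a (left_shift (snd q)) < ?c"
        by (intro order_tendstoD(2)[OF lim]) simp
      then obtain N0 where "\<And>j. N0 \<le> j \<Longrightarrow> cond_freq (\<rho> j) a (left_shift (snd q)) < ?c"
        by (auto simp: eventually_sequentially)
      then have "\<exists>j\<ge>N. \<not> ?c < cond_freq (\<rho> j) a (left_shift (snd q))" for N
        by (intro exI[of _ "max N N0"]) (simp add: not_less less_imp_le)
      then show ?thesis
        using False by (simp add: F_def)
    qed
    then show ?case by blast
  qed
  with Fm show thesis by (rule that)
qed

end

subsection \<open>The map \<open>\<pi>\<^sub>\<mu>\<close>\<close>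

lemma measurable_prob_algebra_cong:
  "sets M = sets N \<Longrightarrow> measurable L (prob_algebra M) = measurable L (prob_algebra N)"
  by (simp add: prob_algebra_def cong: subprob_algebra_cong)

text \<open>The candidate for the law of x given \<sigma>(x) = y: a uniform letter of F(y) put in
  front of y.\<close>

definition resampled :: "((nat \<Rightarrow> 'a::finite) \<Rightarrow> 'a set) \<Rightarrow> (nat \<Rightarrow> 'a) \<Rightarrow> (nat \<Rightarrow> 'a) measure" where
  "resampled F y = distr (measure_pmf (pmf_of_set (F y))) full_shift (\<lambda>a. case_nat a y)"

lemma sets_resampled [simp]: "sets (resampled F y) = sets full_shift"
  by (simp add: resampled_def)

lemma prob_space_resampled: "prob_space (resampled F y)"
  unfolding resampled_def by (intro measure_pmf.prob_space_distr) simp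

lemma emeasure_resampled:
  assumes E: "E \<in> sets full_shift"
  shows "emeasure (resampled F y) E =
    (\<Sum>a\<in>UNIV. ennreal (pmf (pmf_of_set (F y)) a) * indicator E (case_nat a y))"
proof -
  have "emeasure (resampled F y) E = emeasure (measure_pmf (pmf_of_set (F y))) {a. case_nat a y \<in> E}"
    unfolding resampled_def using E by (subst emeasure_distr) (auto simp: vimage_def)
  also have "\<dots> = (\<Sum>a\<in>{a. case_nat a y \<in> E}. ennreal (pmf (pmf_of_set (F y)) a))"
    by (simp add: emeasure_measure_pmf_finite)
  also have "\<dots> = (\<Sum>a\<in>UNIV. ennreal (pmf (pmf_of_set (F y)) a) * indicator E (case_nat a y))"
    by (intro sum.mono_neutral_cong_left) auto
  finally show ?thesis .
qed

lemma measure_resampled: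
  assumes E: "E \<in> sets full_shift"
  shows "measure (resampled F y) E = (\<Sum>a\<in>UNIV. pmf (pmf_of_set (F y)) a * indicator E (case_nat a y))"
proof -
  have "ennreal (measure (resampled F y) E) = ennreal (\<Sum>a\<in>UNIV. pmf (pmf_of_set (F y)) a * indicator E (case_nat a y))"
  proof -
    interpret prob_space "resampled F y" by (rule prob_space_resampled)
    show ?thesis
      unfolding emeasure_eq_measure[symmetric] emeasure_resampled[OF E]
      by (subst sum_ennreal[symmetric]) (auto simp: ennreal_mult'' ennreal_indicator)
  qed
  then show ?thesis
    by (subst (asm) ennreal_inj) (auto intro!: sum_nonneg)
qed

lemma measurable_resampled:
  fixes F :: "(nat \<Rightarrow> 'a::finite) \<Rightarrow> 'a set"
  assumes F: "F \<in> measurable full_shift (count_space UNIV)"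
  shows "resampled F \<in> measurable full_shift (prob_algebra full_shift)"
proof (intro measurable_prob_algebraI measurable_subprob_algebra prob_space_resampled)
  fix E :: "(nat \<Rightarrow> 'a) set" assume E: "E \<in> sets full_shift"
  show "(\<lambda>y. emeasure (resampled F y) E) \<in> borel_measurable full_shift"
    unfolding emeasure_resampled[OF E]
  proof (intro borel_measurable_sum borel_measurable_times_ennreal)
    fix a
    show "(\<lambda>y. ennreal (pmf (pmf_of_set (F y)) a)) \<in> borel_measurable full_shift"
      by (rule measurable_compose[OF F]) simp
    show "(\<lambda>y. indicator E (case_nat a y) :: ennreal) \<in> borel_measurable full_shift"
      by (rule measurable_compose[OF measurable_case_nat]) (use E in simp)
  qed
qed (auto intro: prob_space_imp_subprob_space prob_space_resampled)

section \<open>The conditional measure given the later coordinates\<close>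

context fibred_shift
begin

abbreviation past :: "(nat \<Rightarrow> 'a) measure" where
  "past \<equiv> vimage_algebra (space \<mu>) left_shift \<mu>"

lemma measurable_left_shift_\<mu>: "left_shift \<in> measurable \<mu> \<mu>"
  by (simp add: measurable_cong_sets[OF sets_\<mu> sets_\<mu>])

lemma subalgebra_past: "subalgebra \<mu> past"
  unfolding subalgebra_def
  using measurable_sets[OF measurable_left_shift_\<mu>] by (auto simp: sets_vimage_algebra2 M.space_M)

lemma measurable_left_shift_past: "left_shift \<in> measurable past full_shift"
  using measurable_vimage_algebra1[of left_shift "space \<mu>" \<mu>]
  by (simp add: M.space_M measurable_cong_sets[OF refl sets_\<mu>])

context
  fixes F :: "(nat \<Rightarrow> 'a) \<Rightarrow> 'a set"
  assumes F: "F \<in> measurable full_shift (count_space UNIV)"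
    and AE_F: "AE q in J. F (left_shift (snd q)) = fst q 0"
begin

lemma measurable_resampled_measure:
  assumes E: "E \<in> sets full_shift"
  shows "(\<lambda>y. measure (resampled F y) E) \<in> borel_measurable full_shift"
  using measurable_compose[OF measurable_resampled[OF F] measurable_measure_prob_algebra[OF E]] .

text \<open>Resampling x_0 leaves \<sigma>(x) alone, so the indicator of B passes through, and the
  weights of A_0 are almost surely those of F(\<sigma>(x)). This is the defining identity of a
  conditional probability on the events of \<open>past\<close>.\<close>

lemma integral_resampled:
  assumes B: "B \<in> sets full_shift" and E: "E \<in> sets full_shift"
  shows "(\<integral>x. indicator B (left_shift x) * indicator E x \<partial>\<mu>) =
    (\<integral>x. indicator B (left_shift x) * measure (resampled F (left_shift x)) E \<partial>\<mu>)"
proof -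
  have iB: "(\<lambda>x. indicator B (left_shift x) :: real) \<in> borel_measurable full_shift"
    by (rule measurable_compose[OF measurable_left_shift]) (use B in simp)
  have m1: "(\<lambda>x. indicator B (left_shift x) * indicator E x :: real) \<in> borel_measurable full_shift"
    using E by (intro borel_measurable_times iB) simp
  have m2: "(\<lambda>x. indicator B (left_shift x) * measure (resampled F (left_shift x)) E :: real) \<in> borel_measurable full_shift"
    by (intro borel_measurable_times iB measurable_compose[OF measurable_left_shift measurable_resampled_measure[OF E]])
  let ?f = "\<lambda>q :: (nat \<Rightarrow> 'a set) \<times> (nat \<Rightarrow> 'a). indicator B (left_shift (snd q)) * indicator E (snd q) :: real"
  have f: "?f \<in> borel_measurable F2"
    by (rule measurable_compose[OF measurable_snd m1])
  have Rm: "(\<lambda>q. \<Sum>a\<in>UNIV. weight (fst q) a * ?f (fst q, case_nat a (left_shift (snd q)))) \<in> borel_measurable J"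
    unfolding measurable_J_iff
    by (intro borel_measurable_sum borel_measurable_times[OF measurable_weight] measurable_compose[OF measurable_replace f])
  have "(\<integral>x. indicator B (left_shift x) * indicator E x \<partial>\<mu>) = (\<integral>q. ?f q \<partial>J)"
    by (rule integral_J_snd[OF m1, symmetric])
  also have "\<dots> = (\<integral>q. (\<Sum>a\<in>UNIV. weight (fst q) a * ?f (fst q, case_nat a (left_shift (snd q)))) \<partial>J)"
    by (rule integral_resample[OF f, of 1]) (simp add: indicator_def)
  also have "\<dots> = (\<integral>q. indicator B (left_shift (snd q)) * measure (resampled F (left_shift (snd q))) E \<partial>J)"
  proof (rule integral_cong_AE[OF Rm])
    show "(\<lambda>q. indicator B (left_shift (snd q)) * measure (resampled F (left_shift (snd q))) E) \<in> borel_measurable J"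
      unfolding measurable_J_iff by (rule measurable_compose[OF measurable_snd m2])
    show "AE q in J. (\<Sum>a\<in>UNIV. weight (fst q) a * ?f (fst q, case_nat a (left_shift (snd q)))) =
        indicator B (left_shift (snd q)) * measure (resampled F (left_shift (snd q))) E"
      using AE_F
    proof eventually_elim
      case (elim q)
      show ?case
        unfolding measure_resampled[OF E] elim sum_distrib_left
        by (intro sum.cong refl) (simp add: mult_ac)
    qed
  qed
  also have "\<dots> = (\<integral>x. indicator B (left_shift x) * measure (resampled F (left_shift x)) E \<partial>\<mu>)"
    by (rule integral_J_snd[OF m2])
  finally show ?thesis .
qed

lemma regular_cond_prob_resampled: "regular_cond_prob \<mu> past (\<lambda>x. resampled F (left_shift x))"
  unfolding regular_cond_prob_def
proof (intro conjI ballI)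
  show "(\<lambda>x. resampled F (left_shift x)) \<in> measurable past (prob_algebra \<mu>)"
    unfolding measurable_prob_algebra_cong[OF sets_\<mu>]
    by (rule measurable_compose[OF measurable_left_shift_past measurable_resampled[OF F]])
  fix E assume "E \<in> sets \<mu>"
  then have E: "E \<in> sets full_shift"
    by (simp add: sets_\<mu>)
  interpret S: sigma_finite_subalgebra \<mu> past
    by (rule finite_measure_subalgebra_is_sigma_finite)
      (intro finite_measure_subalgebra.intro finite_measure_subalgebra_axioms.intro subalgebra_past M.finite_measure_axioms)
  have g: "(\<lambda>x. measure (resampled F (left_shift x)) E) \<in> borel_measurable past"
    by (rule measurable_compose[OF measurable_left_shift_past measurable_resampled_measure[OF E]])
  have "AE x in \<mu>. real_cond_exp \<mu> past (indicator E) x = measure (resampled F (left_shift x)) E"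
  proof (rule S.real_cond_exp_charact)
    fix B assume "B \<in> sets past"
    then obtain C where C: "C \<in> sets full_shift" "B = left_shift -` C"
      by (auto simp: sets_vimage_algebra2 M.space_M sets_\<mu>)
    have "indicator B x = (indicator C (left_shift x) :: real)" for x :: "nat \<Rightarrow> 'a"
      by (simp add: C indicator_def)
    then show "(\<integral>x\<in>B. indicator E x \<partial>\<mu>) = (\<integral>x\<in>B. measure (resampled F (left_shift x)) E \<partial>\<mu>)"
      using integral_resampled[OF C(1) E] by (simp add: set_lebesgue_integral_def)
  next
    show "integrable \<mu> (indicator E :: _ \<Rightarrow> real)"
      using E by (intro integrable_real_indicator) (simp_all add: sets_\<mu> M.emeasure_eq_measure)
    show "integrable \<mu> (\<lambda>x. measure (resampled F (left_shift x)) E)"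
      using measurable_from_subalg[OF subalgebra_past g] prob_space.prob_le_1[OF prob_space_resampled]
      by (intro M.integrable_const_bound[where B=1]) auto
  qed (rule g)
  then show "AE x in \<mu>. measure (resampled F (left_shift x)) E = real_cond_exp \<mu> past (indicator E) x"
    by eventually_elim simp
qed

text \<open>The chosen version is a genuine one because the explicit kernel shows that versions
  exist.\<close>

lemma regular_cond_prob_cond_measure: "regular_cond_prob \<mu> past (cond_measure \<mu> past)"
  unfolding cond_measure_def by (rule someI[of "regular_cond_prob \<mu> past"]) (rule regular_cond_prob_resampled)

lemma measurable_cond_measure: "cond_measure \<mu> past \<in> measurable \<mu> (prob_algebra \<mu>)"
  using regular_cond_prob_cond_measure measurable_from_subalg[OF subalgebra_past]
  by (auto simp: regular_cond_prob_def)

text \<open>Two versions agree almost surely on each of the countably many cylinders, hence on all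
  of them outside one null set, and cylinders determine the measure.\<close>

lemma AE_cond_measure: "AE x in \<mu>. cond_measure \<mu> past x = resampled F (left_shift x)"
proof -
  have "AE x in \<mu>. \<forall>w :: 'a list. measure (cond_measure \<mu> past x) (cyl w) = measure (resampled F (left_shift x)) (cyl w)"
    unfolding AE_all_countable
  proof
    fix w :: "'a list"
    have "AE x in \<mu>. measure (cond_measure \<mu> past x) (cyl w) = real_cond_exp \<mu> past (indicator (cyl w)) x"
      "AE x in \<mu>. measure (resampled F (left_shift x)) (cyl w) = real_cond_exp \<mu> past (indicator (cyl w)) x"
      using regular_cond_prob_cond_measure regular_cond_prob_resampled M.cyl_events[of w]
      unfolding regular_cond_prob_def by blast+
    then show "AE x in \<mu>. measure (cond_measure \<mu> past x) (cyl w) = measure (resampled F (left_shift x)) (cyl w)"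
      by eventually_elim simp
  qed
  then show ?thesis
  proof eventually_elim
    case (elim x)
    have "cond_measure \<mu> past x \<in> space (prob_algebra \<mu>)"
      using measurable_space[OF measurable_cond_measure, of x] by (simp add: M.space_M)
    then have 1: "sets (cond_measure \<mu> past x) = sets full_shift" "prob_space (cond_measure \<mu> past x)"
      by (auto simp: space_prob_algebra sets_\<mu>)
    interpret C: prob_space "cond_measure \<mu> past x" by fact
    interpret R: prob_space "resampled F (left_shift x)" by (rule prob_space_resampled)
    show ?case
      using elim by (intro measure_eqI_cyl) (auto simp: 1 C.emeasure_eq_measure R.emeasure_eq_measure C.finite_measure_axioms)
  qed
qed

lemma singleton_in_sets: "{x :: nat \<Rightarrow> 'a} \<in> sets full_shift"
proof -
  have "{x} = (\<Inter>n. cyl (word n x))"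
    by (auto simp: in_cyl_word word_eq_iff fun_eq_iff) (metis lessI)
  then show ?thesis
    by (simp add: cyl_in_sets)
qed

text \<open>Exactly one letter put in front of \<sigma>(x) gives x(0 := a), namely a itself; so this
  point has the mass of a under q, which is positive precisely on A_0.\<close>

lemma AE_Lambda_set: "AE q in J. Lambda_set \<mu> (snd q) = fst q 0"
  using AE_J_snd[OF AE_cond_measure] AE_F AE_J_nonempty
proof eventually_elim
  case (elim q)
  have "measure (resampled F (left_shift (snd q))) {(snd q)(0 := a)} = weight (fst q) a" for a
  proof -
    have "case_nat b (left_shift (snd q)) = (snd q)(0 := a) \<longleftrightarrow> b = a" for b
      by (auto simp: case_nat_left_shift fun_upd_idem_iff dest: fun_cong[of _ _ 0])
    then have "measure (resampled F (left_shift (snd q))) {(snd q)(0 := a)} =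
        (\<Sum>b\<in>UNIV. if b = a then weight (fst q) b else 0)"
      unfolding measure_resampled[OF singleton_in_sets] elim(2) by (intro sum.cong refl) (simp add: indicator_def)
    then show ?thesis by simp
  qed
  then show ?case
    unfolding Lambda_set_def elim(1) using elim(3) by (auto simp: pmf_of_set card_gt_0_iff indicator_def)
qed

text \<open>The singleton being measured moves with x, so measurability of the kernel on fixed
  events is not enough; it is applied to the graph of x \<mapsto> x(0 := a), a measurable set of
  pairs.\<close>

lemma measurable_Lambda_set: "Lambda_set \<mu> \<in> measurable \<mu> (count_space UNIV)"
proof (subst measurable_count_space_eq2_countable, safe)
  fix B :: "'a set"
  have a: "{x. a \<in> Lambda_set \<mu> x} \<in> sets \<mu>" for a
  proof -
    have "(SIGMA x:space \<mu>. {x(0 := a)}) =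
      {q :: (nat \<Rightarrow> 'a) \<times> (nat \<Rightarrow> 'a). snd q 0 = a} \<inter> (\<Inter>i. {q. snd q (Suc i) = fst q (Suc i)})"
      by (auto simp: M.space_M fun_eq_iff gr0_conv_Suc)
    also have "\<dots> \<in> sets (full_shift \<Otimes>\<^sub>M full_shift)"
      by (intro sets.Int sets.countable_INT in_sets_pair_coord[of "\<lambda>_ b. b = a"])
        (auto intro: in_sets_pair_coord[of "\<lambda>b c. c = b"])
    finally have "(\<lambda>x. measure (cond_measure \<mu> past x) {x(0 := a)}) \<in> borel_measurable \<mu>"
      by (intro measure_measurable_prob_algebra2[OF _ measurable_cond_measure])
        (simp add: sets_pair_measure_cong[OF sets_\<mu> sets_\<mu>])
    then have "{x \<in> space \<mu>. 0 < measure (cond_measure \<mu> past x) {x(0 := a)}} \<in> sets \<mu>"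
      by measurable
    then show ?thesis
      by (simp add: Lambda_set_def M.space_M)
  qed
  have "Lambda_set \<mu> -` {B} \<inter> space \<mu> =
    (\<Inter>a\<in>UNIV. if a \<in> B then {x. a \<in> Lambda_set \<mu> x} else space \<mu> - {x. a \<in> Lambda_set \<mu> x})"
    by (auto simp: M.space_M split: if_splits)
  also have "\<dots> \<in> sets \<mu>"
    using a sets.Diff[OF sets.top a] by (intro sets.finite_INT) auto
  finally show "Lambda_set \<mu> -` {B} \<inter> space \<mu> \<in> sets \<mu>" .
qed auto

lemma measurable_pi_map: "pi_map \<mu> \<in> measurable \<mu> full_shift"
proof (rule measurable_into_full_shift)
  fix i
  have "left_shift ^^ i \<in> measurable \<mu> \<mu>"
    by (rule measurable_compose_n[OF measurable_left_shift_\<mu>])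
  then show "(\<lambda>x. pi_map \<mu> x i) \<in> measurable \<mu> (count_space UNIV)"
    unfolding pi_map_def by (rule measurable_compose[OF _ measurable_Lambda_set])
qed

text \<open>Coordinate i reduces to coordinate 0 by shifting: invariance of \<nu> transports the
  null set in the base, and \<open>left_shift\<close> maps the fibre over A to the fibre over its
  shift.\<close>

lemma AE_pi_map: "AE q in J. pi_map \<mu> (snd q) = fst q"
proof -
  have Lm: "(\<lambda>x. Lambda_set \<mu> ((left_shift ^^ i) x)) \<in> measurable full_shift (count_space UNIV)" for i
    using measurable_compose[OF measurable_pi_map measurable_shift_coord, of i]
    by (simp add: pi_map_def measurable_cong_sets[OF sets_\<mu> refl])
  have S: "{q. Lambda_set \<mu> ((left_shift ^^ i) (snd q)) = fst q i} \<in> sets F2" for i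
  proof -
    have "{q. Lambda_set \<mu> ((left_shift ^^ i) (snd q)) = fst q i} =
      (\<Union>B. ((\<lambda>q. Lambda_set \<mu> ((left_shift ^^ i) (snd q))) -` {B} \<inter> space F2) \<inter> ((\<lambda>q. fst q i) -` {B} \<inter> space F2))"
      by (auto simp: space_pair_measure)
    also have "\<dots> \<in> sets F2"
      by (intro sets.finite_UN sets.Int measurable_sets[OF measurable_compose[OF measurable_snd Lm]]
          measurable_sets[OF measurable_compose[OF measurable_fst measurable_shift_coord]]) auto
    finally show ?thesis .
  qed
  have "AE A in \<nu>. AE x in fibre_measure A. Lambda_set \<mu> ((left_shift ^^ i) x) = A i" for i
  proof (induction i)
    case 0
    then show ?case
      using AE_Lambda_set AE_joint_measure[OF N.sets_M N.prob_space_axioms S[of 0]] by simp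
  next
    case (Suc i)
    have inv: "left_shift \<in> measurable \<nu> \<nu>" "distr \<nu> \<nu> left_shift = \<nu>"
      using N.invariant by (auto simp: invariant_measure_def)
    have "AE A in \<nu>. AE x in fibre_measure (left_shift A). Lambda_set \<mu> ((left_shift ^^ i) x) = left_shift A i"
      by (rule AE_distrD[OF inv(1)]) (simp only: inv(2) Suc.IH)
    then show ?case
    proof eventually_elim
      case (elim A)
      have "AE x in distr (fibre_measure A) full_shift left_shift. Lambda_set \<mu> ((left_shift ^^ i) x) = left_shift A i"
        using elim by (simp only: distr_fibre_measure_left_shift)
      then have "AE x in fibre_measure A. Lambda_set \<mu> ((left_shift ^^ i) (left_shift x)) = left_shift A i"
        by (intro AE_distrD[of left_shift "fibre_measure A" full_shift]) auto
      then show ?case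
        by (simp add: left_shift_def[of A] funpow_Suc_right del: funpow.simps)
    qed
  qed
  then have "AE q in J. Lambda_set \<mu> ((left_shift ^^ i) (snd q)) = fst q i" for i
    by (subst AE_joint_measure[OF N.sets_M N.prob_space_axioms S]) simp
  then have "AE q in J. \<forall>i. Lambda_set \<mu> ((left_shift ^^ i) (snd q)) = fst q i"
    by (simp add: AE_all_countable)
  then show ?thesis
    by eventually_elim (simp add: pi_map_def fun_eq_iff)
qed

lemma distr_pi_map_of_recovered_head: "distr \<mu> full_shift (pi_map \<mu>) = \<nu>"
proof -
  have "distr \<mu> full_shift (pi_map \<mu>) = distr (distr J \<mu> snd) full_shift (pi_map \<mu>)"
    by (simp only: distr_J_snd)
  also have "\<dots> = distr J full_shift (pi_map \<mu> \<circ> snd)"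
    by (rule distr_distr[OF measurable_pi_map measurable_snd_J])
  also have "\<dots> = distr J full_shift fst"
    using AE_pi_map measurable_comp[OF measurable_snd_J measurable_pi_map]
    by (intro distr_cong_AE) (auto simp: measurable_J_iff)
  also have "\<dots> = \<nu>"
    by (rule distr_joint_fst[OF N.sets_M N.prob_space_axioms])
  finally show ?thesis .
qed

end

lemma distr_pi_map:
  assumes "ks_entropy \<nu> left_shift = 0"
  shows "distr \<mu> full_shift (pi_map \<mu>) = \<nu>"
proof -
  obtain F where "F \<in> measurable full_shift (count_space UNIV)" "AE q in J. F (left_shift (snd q)) = fst q 0"
    using recover_head[OF N.block_entropy_limit_0[OF assms]] .
  then show ?thesis
    by (rule distr_pi_map_of_recovered_head)
qed

end

theorem theorem6p6:
  fixes \<tau> :: "(nat \<Rightarrow> 'a::finite) \<Rightarrow> nat \<Rightarrow> 'a"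
    and \<nu> :: "(nat \<Rightarrow> 'a set) measure"
    and \<mu> :: "(nat \<Rightarrow> 'a) measure"
  assumes "left_permutative_ca \<tau>"
    and "sets \<nu> = sets full_shift" and "prob_space \<nu>" and "emeasure \<nu> (Z \<tau>) = 1"
    and "invariant_measure \<nu> left_shift" and "invariant_measure \<nu> (set_ca \<tau>)"
    and "\<mu> = projected_measure \<nu>"
  shows "(invariant_measure \<mu> left_shift \<and> invariant_measure \<mu> \<tau>) \<and>
    (bipermutative_ca \<tau> \<and> ks_entropy \<nu> left_shift = 0 \<longrightarrow>
       distr \<mu> full_shift (pi_map \<mu>) = \<nu>) \<and>
    (bipermutative_ca \<tau> \<and> ks_entropy \<nu> left_shift = 0 \<and> jointly_ergodic \<nu> {left_shift, set_ca \<tau>} \<longrightarrow>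
       jointly_ergodic \<mu> {left_shift, \<tau>})"
proof -
  obtain r where r: "\<And>x i. \<tau> x i = r (x i) (x (Suc i))" and bij: "\<And>a. bij (\<lambda>b. r b a)"
    using assms(1) by (auto simp: left_permutative_ca_def)
  interpret \<nu>: prob_space \<nu> by fact
  \<comment> \<open>Nonmeasurable sets get the value 0, so the value 1 already forces
    measurability.\<close>
  have "Z \<tau> \<in> sets \<nu>"
    using assms(4) by (metis emeasure_notin_sets zero_neq_one)
  then have Z: "AE A in \<nu>. A \<in> Z \<tau>"
    using assms(4) by (simp add: \<nu>.AE_in_set_eq_1 \<nu>.emeasure_eq_measure)
  then have nonempty: "AE A in \<nu>. \<forall>i. A i \<noteq> {}"
    by eventually_elim (auto dest: Z_D(1))
  interpret fibred_shift \<nu>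
    using assms(2,5) nonempty
    by (intro fibred_shift.intro shift_measure.intro shift_measure_axioms.intro fibred_shift_axioms.intro \<nu>.prob_space_axioms)
  have \<mu>: "\<mu> = \<nu> \<bind> fibre_measure"
    unfolding assms(7) by (rule projected_measure_eq[OF assms(2,3) nonempty])
  have \<tau>: "\<tau> \<in> measurable full_shift full_shift"
    using r by (rule measurable_ca)
  have fibre: "AE A in \<nu>. distr (fibre_measure A) full_shift \<tau> = fibre_measure (set_ca \<tau> A)"
    using Z by eventually_elim (rule distr_fibre_measure_ca[OF r bij], auto dest: Z_D)
  show ?thesis
    unfolding \<mu> using M.invariant invariant_measure_bind_fibre[OF assms(2,3) \<tau> assms(6) fibre] distr_pi_map
      jointly_ergodic_bind_fibre[OF assms(2,3,5) \<tau> fibre] by blast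
qed

end
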